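(* Let $n\ge 2$. The variety $\mathbf{V(C_n^{dp})}\vee\mathbf{V(D_2)}$ is defined, modulo $\mathbf{JIDL_1}$, by the identity $$x_1\vee x_2\vee\cdots\vee x_n\vee(x_1\to x_2)\vee(x_2\to x_3)\vee\cdots\vee(x_{n-1}\to x_n)\approx 1;$$ that is, it is exactly the class of algebras in $\mathbf{JIDL_1}$ satisfying this identity.
   Context: A semi-Heyting algebra is an algebra $\langle L,\vee,\wedge,\to,0,1\rangle$ such that $\langle L,\vee,\wedge,0,1\rangle$ is a bounded lattice and the identities $x\wedge(x\to y)\approx x\wedge y$, $x\wedge(y\to z)\approx x\wedge[(x\wedge y)\to(x\wedge z)]$, $x\to x\approx 1$ hold; it is a Heyting algebra if moreover $(x\wedge y)\to y\approx 1$. Write $x^*:=x\to 0$. A $\mathbf{DQD}$-algebra (dually quasi-De Morgan semi-Heyting algebra) is an algebra $\langle L,\vee,\wedge,\to,{}',0,1\rangle$ whose reduct $\langle L,\vee,\wedge,\to,0,1\rangle$ is a semi-Heyting algebra and which satisfies: $0'\approx 1$ and $1'\approx 0$; $(x\wedge y)'\approx x'\vee y'$; $(x\vee y)''\approx x''\vee y''$; $x''\le x$. $\mathbf{DQD}$ denotes the variety of all $\mathbf{DQD}$-algebras. $\mathbf{JIDL_1}$ is the subvariety of $\mathbf{DQD}$ defined by the identities $x'\vee(y\to z)\approx(x'\vee y)\to(x'\vee z)$, $(x\to y)\vee(y\to x)\approx 1$, and $x\wedge x'^{*}\approx (x\wedge x'^{*})'^{*}$ (where $z'^*$ means $(z')^*$);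 in the presence of the first identity, the last is equivalent to the level-1 identity $x\wedge x'^*\approx x\wedge x'^*\wedge x'^*{}'^*$. A dually Stone Heyting chain is a $\mathbf{DQD}$-algebra satisfying $x'\wedge x''\approx 0$ whose semi-Heyting reduct is a Heyting algebra and whose lattice reduct is a chain; $\mathbf{C_n^{dp}}$ is the (unique up to isomorphism) $n$-element dually Stone Heyting chain. $\mathbf{D_2}$ is the $\mathbf{DQD}$-algebra whose reduct without $'$ is the four-element Boolean algebra $\{0,a,b,1\}$ with its Heyting implication ($x\to y$ is the join of the complement of $x$ with $y$), and with $0'=1$, $1'=0$, $a'=a$, $b'=b$. $\mathbf{V(K)}$ denotes the variety generated by $\mathbf{K}$, and $\vee$ between varieties is the join of varieties. *)

theory Defs
  imports Main "HOL-Library.Infinite_Typeclass"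
begin

section \<open>Algebras, terms and varieties in the signature of DQD-algebras\<close>

record 'a dqd_struct =
  carrier :: "'a set"
  join :: "'a \<Rightarrow> 'a \<Rightarrow> 'a"
  meet :: "'a \<Rightarrow> 'a \<Rightarrow> 'a"
  imp :: "'a \<Rightarrow> 'a \<Rightarrow> 'a"
  dual :: "'a \<Rightarrow> 'a"
  zero :: 'a
  one :: 'a

definition is_algebra :: "'a dqd_struct \<Rightarrow> bool" where
  "is_algebra A \<longleftrightarrow>
     zero A \<in> carrier A \<and> one A \<in> carrier A \<and>
     (\<forall>a\<in>carrier A. dual A a \<in> carrier A) \<and>
     (\<forall>a\<in>carrier A. \<forall>b\<in>carrier A.
        join A a b \<in> carrier A \<and> meet A a b \<in> carrier A \<and> imp A a b \<in> carrier A)"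

datatype tm =
    Var nat
  | Zero
  | One
  | Join tm tm (infixr \<open>\<^bold>\<or>\<close> 65)
  | Meet tm tm (infixr \<open>\<^bold>\<and>\<close> 70)
  | Imp tm tm (infixr \<open>\<^bold>\<rightarrow>\<close> 60)
  | Dual tm

text \<open>The pseudocomplement of \<open>t\<close>.\<close>

abbreviation star :: "tm \<Rightarrow> tm" where
  "star t \<equiv> t \<^bold>\<rightarrow> Zero"

type_synonym identity = "tm \<times> tm"

abbreviation identity_of :: "tm \<Rightarrow> tm \<Rightarrow> identity" (infix \<open>\<approx>\<close> 50) where
  "s \<approx> t \<equiv> (s, t)"

primrec eval :: "'a dqd_struct \<Rightarrow> (nat \<Rightarrow> 'a) \<Rightarrow> tm \<Rightarrow> 'a" where
  "eval A \<rho> (Var i) = \<rho> i"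
| "eval A \<rho> Zero = zero A"
| "eval A \<rho> One = one A"
| "eval A \<rho> (s \<^bold>\<or> t) = join A (eval A \<rho> s) (eval A \<rho> t)"
| "eval A \<rho> (s \<^bold>\<and> t) = meet A (eval A \<rho> s) (eval A \<rho> t)"
| "eval A \<rho> (s \<^bold>\<rightarrow> t) = imp A (eval A \<rho> s) (eval A \<rho> t)"
| "eval A \<rho> (Dual t) = dual A (eval A \<rho> t)"

definition satisfies :: "'a dqd_struct \<Rightarrow> identity \<Rightarrow> bool" (infix \<open>\<Turnstile>\<close> 49) where
  "A \<Turnstile> e \<longleftrightarrow> (\<forall>\<rho>. range \<rho> \<subseteq> carrier A \<longrightarrow> eval A \<rho> (fst e) = eval A \<rho> (snd e))"

text \<open>The variety defined by a set of identities, restricted to algebras with carrier in \<open>'a\<close>.\<close>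

definition models :: "identity set \<Rightarrow> 'a dqd_struct set" where
  "models \<Sigma> = {A. is_algebra A \<and> (\<forall>e\<in>\<Sigma>. A \<Turnstile> e)}"

text \<open>
  Varieties are equational classes, so the variety generated by \<open>K\<close> is the intersection of all
  equational classes containing \<open>K\<close>.  The generating algebras may live on another type than
  the members of the variety, since sets of identities do not depend on the type.
\<close>

definition variety_of :: "'b dqd_struct set \<Rightarrow> 'a dqd_struct set" where
  "variety_of K = \<Inter>{models \<Sigma> |\<Sigma>. K \<subseteq> models \<Sigma>}"

text \<open>
  The join is the least variety containing both arguments.  The carrier type has to be infinite:
  a variety of countable signature is determined by its countable members, but on a finite type
  only its small finite members would be seen.
\<close>

definition variety_join ::
    "'a::infinite dqd_struct set \<Rightarrow> 'a dqd_struct set \<Rightarrow> 'a dqd_struct set" (infixl \<open>\<squnion>\<^sub>V\<close> 65) where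
  "V \<squnion>\<^sub>V W = \<Inter>{models \<Sigma> |\<Sigma>. V \<subseteq> models \<Sigma> \<and> W \<subseteq> models \<Sigma>}"


section \<open>DQD-algebras and the variety \<open>JIDL\<^sub>1\<close>\<close>

abbreviation vx :: tm where "vx \<equiv> Var 0"
abbreviation vy :: tm where "vy \<equiv> Var 1"
abbreviation vz :: tm where "vz \<equiv> Var 2"

definition bounded_lattice_ids :: "identity set" where
  "bounded_lattice_ids =
    { vx \<^bold>\<or> vy \<approx> vy \<^bold>\<or> vx,
      vx \<^bold>\<and> vy \<approx> vy \<^bold>\<and> vx,
      (vx \<^bold>\<or> vy) \<^bold>\<or> vz \<approx> vx \<^bold>\<or> (vy \<^bold>\<or> vz),
      (vx \<^bold>\<and> vy) \<^bold>\<and> vz \<approx> vx \<^bold>\<and> (vy \<^bold>\<and> vz),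
      vx \<^bold>\<or> (vx \<^bold>\<and> vy) \<approx> vx,
      vx \<^bold>\<and> (vx \<^bold>\<or> vy) \<approx> vx,
      vx \<^bold>\<or> Zero \<approx> vx,
      vx \<^bold>\<and> One \<approx> vx }"

definition semi_heyting_ids :: "identity set" where
  "semi_heyting_ids = bounded_lattice_ids \<union>
    { vx \<^bold>\<and> (vx \<^bold>\<rightarrow> vy) \<approx> vx \<^bold>\<and> vy,
      vx \<^bold>\<and> (vy \<^bold>\<rightarrow> vz) \<approx> vx \<^bold>\<and> ((vx \<^bold>\<and> vy) \<^bold>\<rightarrow> (vx \<^bold>\<and> vz)),
      (vx \<^bold>\<rightarrow> vx) \<approx> One }"

text \<open>The last identity expresses \<open>x'' \<le> x\<close>.\<close>

definition DQD_ids :: "identity set" where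
  "DQD_ids = semi_heyting_ids \<union>
    { Dual Zero \<approx> One,
      Dual One \<approx> Zero,
      Dual (vx \<^bold>\<and> vy) \<approx> Dual vx \<^bold>\<or> Dual vy,
      Dual (Dual (vx \<^bold>\<or> vy)) \<approx> Dual (Dual vx) \<^bold>\<or> Dual (Dual vy),
      Dual (Dual vx) \<^bold>\<and> vx \<approx> Dual (Dual vx) }"

definition DQD :: "'a dqd_struct set" where
  "DQD = models DQD_ids"

definition JIDL1 :: "'a dqd_struct set" where
  "JIDL1 = models (DQD_ids \<union>
    { Dual vx \<^bold>\<or> (vy \<^bold>\<rightarrow> vz) \<approx> ((Dual vx \<^bold>\<or> vy) \<^bold>\<rightarrow> (Dual vx \<^bold>\<or> vz)),
      (vx \<^bold>\<rightarrow> vy) \<^bold>\<or> (vy \<^bold>\<rightarrow> vx) \<approx> One,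
      vx \<^bold>\<and> star (Dual vx) \<approx> star (Dual (vx \<^bold>\<and> star (Dual vx))) })"


section \<open>The generating algebras\<close>

definition is_chain :: "'a dqd_struct \<Rightarrow> bool" where
  "is_chain A \<longleftrightarrow> (\<forall>a\<in>carrier A. \<forall>b\<in>carrier A. meet A a b = a \<or> meet A a b = b)"

definition dually_stone_heyting_chain :: "'a dqd_struct \<Rightarrow> bool" where
  "dually_stone_heyting_chain A \<longleftrightarrow>
     A \<in> DQD \<and>
     A \<Turnstile> Dual vx \<^bold>\<and> Dual (Dual vx) \<approx> Zero \<and>
     A \<Turnstile> ((vx \<^bold>\<and> vy) \<^bold>\<rightarrow> vy) \<approx> One \<and>
     is_chain A"

text \<open>
  The four-element Boolean algebra is realised as the square of the two-element one, with atoms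
  \<open>a = (True, False)\<close> and \<open>b = (False, True)\<close>; the dual operation swaps the bounds and fixes the atoms.
\<close>

definition D2 :: "(bool \<times> bool) dqd_struct" where
  "D2 = \<lparr> carrier = UNIV,
     join = (\<lambda>(p, q) (r, s). (p \<or> r, q \<or> s)),
     meet = (\<lambda>(p, q) (r, s). (p \<and> r, q \<and> s)),
     imp = (\<lambda>(p, q) (r, s). (\<not> p \<or> r, \<not> q \<or> s)),
     dual = (\<lambda>u. if u = (False, False) then (True, True)
               else if u = (True, True) then (False, False) else u),
     zero = (False, False),
     one = (True, True) \<rparr>"

lemma D2_in_DQD: "D2 \<in> DQD"
  by (auto simp: DQD_def models_def DQD_ids_def semi_heyting_ids_def bounded_lattice_ids_def
      satisfies_def is_algebra_def D2_def split: prod.splits)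

text \<open>An \<open>n\<close>-element dually Stone Heyting chain exists for every \<open>n \<ge> 2\<close>.\<close>

lemma dually_stone_heyting_chain_exists:
  assumes "n \<ge> 2"
  shows "\<exists>C :: nat dqd_struct. dually_stone_heyting_chain C \<and> card (carrier C) = n"
proof -
  define C where "C = \<lparr> carrier = {..<n}, join = max, meet = min,
     imp = (\<lambda>i j. if i \<le> j then n - 1 else j),
     dual = (\<lambda>i. if i = n - 1 then 0 else n - 1), zero = 0, one = n - 1 \<rparr>"
  have lt: "\<rho> i < n" if "range \<rho> \<subseteq> {..<n}" for \<rho> :: "nat \<Rightarrow> nat" and i
    using that by auto
  have le: "\<rho> i \<le> n - Suc 0" if "range \<rho> \<subseteq> {..<n}" for \<rho> :: "nat \<Rightarrow> nat" and i
    using lt[OF that, of i] by simp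
  have top: "n - Suc 0 \<le> \<rho> i \<longleftrightarrow> \<rho> i = n - Suc 0" if "range \<rho> \<subseteq> {..<n}"
    for \<rho> :: "nat \<Rightarrow> nat" and i
    using le[OF that, of i] by auto
  have "dually_stone_heyting_chain C"
    using assms unfolding dually_stone_heyting_chain_def DQD_def models_def DQD_ids_def
      semi_heyting_ids_def bounded_lattice_ids_def satisfies_def is_algebra_def is_chain_def C_def
    by (auto simp: min_def max_def le top)
  then show ?thesis
    by (intro exI[of _ C]) (simp add: C_def)
qed


section \<open>The defining identity\<close>

fun big_join :: "tm list \<Rightarrow> tm" where
  "big_join [] = Zero"
| "big_join [t] = t"
| "big_join (t # u # ts) = t \<^bold>\<or> big_join (u # ts)"

definition chain_identity :: "nat \<Rightarrow> identity" where
  "chain_identity n =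
     (big_join (map Var [1..<n+1] @ map (\<lambda>i. Var i \<^bold>\<rightarrow> Var (i + 1)) [1..<n]) \<approx> One)"

end

theory Submission
  imports Defs
begin

text \<open>
  Both generators are finite, so each has an isomorphic copy on the infinite type \<open>'a\<close>, and the join
  of the two varieties consists of the algebras that satisfy every identity valid in both \<open>C\<close> and
  \<open>D2\<close> (\<open>variety_join_eq\<close>).  The generators themselves belong to \<open>JIDL1\<close> and satisfy the chain
  identity, by direct computation; for \<open>C\<close> this is done in a concrete \<open>n\<close>-element chain of natural
  numbers, to which \<open>C\<close> is isomorphic by ranking its elements.  It remains to separate any two
  distinct elements \<open>a\<close>, \<open>b\<close> of an algebra \<open>A\<close> in \<open>JIDL1\<close> with the chain identity by a
  homomorphism into the \<open>n\<close>-element chain or into \<open>D2\<close> (\<open>separating_hom\<close>).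

  The first identity of \<open>JIDL1\<close>, taken at \<open>y = x'\<close> and \<open>z = 0\<close>, makes every \<open>x'\<close> complemented
  by \<open>x'\<^sup>*\<close>.  Call \<open>e\<close> central if \<open>e'\<^sup>* = e\<close>.  Then \<open>e'\<close> is a complement of \<open>e\<close> and again central,
  and for each central \<open>e\<close> the relation \<open>x \<and> e = y \<and> e\<close> is a congruence.  The last identity of
  \<open>JIDL1\<close> says that \<open>x \<and> x'\<^sup>*\<close> is always central.  Zorn's lemma yields an ultrafilter \<open>U\<close> of central
  elements such that \<open>a\<close> and \<open>b\<close> agree at no \<open>e\<close> in \<open>U\<close>; in the quotient by the congruence that
  identifies \<open>x\<close> and \<open>y\<close> when they agree at some \<open>e\<close> in \<open>U\<close> the elements \<open>a\<close> and \<open>b\<close> remain distinct and each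
  \<open>x \<and> x'\<^sup>*\<close> is 0 or 1 (\<open>simple_quotient\<close>).

  In such a quotient \<open>x \<le> x'\<close> for all \<open>x \<noteq> 1\<close>, whence \<open>x = 1\<close> or \<open>x' = 1\<close> or \<open>x' = x\<close>
  (\<open>dual_cases\<close>).  If some \<open>a \<noteq> 1\<close> has \<open>a' = a\<close>, its complement \<open>b\<close> has the same property, both are
  atoms, and the quotient is \<open>D2\<close>.  Otherwise \<open>x'' = 0\<close> for all \<open>x \<noteq> 1\<close>; as \<open>''\<close> preserves joins,
  1 is join-irreducible, and prelinearity makes the quotient a dually Stone Heyting chain.  The
  chain identity passes to the quotient, where it bounds the number of elements by \<open>n\<close>
  (\<open>card_le_if_chain_identity\<close>), so that the quotient embeds in the \<open>n\<close>-element chain.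
\<close>

section \<open>Homomorphisms and identities\<close>

text \<open>Operation-preserving maps between algebras of the signature.\<close>

definition dqd_hom :: "('a \<Rightarrow> 'b) \<Rightarrow> 'a dqd_struct \<Rightarrow> 'b dqd_struct \<Rightarrow> bool" where
  "dqd_hom h A B \<longleftrightarrow>
     (\<forall>x\<in>carrier A. h x \<in> carrier B) \<and> h (zero A) = zero B \<and> h (one A) = one B \<and>
     (\<forall>x\<in>carrier A. h (dual A x) = dual B (h x)) \<and>
     (\<forall>x\<in>carrier A. \<forall>y\<in>carrier A. h (join A x y) = join B (h x) (h y) \<and>
        h (meet A x y) = meet B (h x) (h y) \<and> h (imp A x y) = imp B (h x) (h y))"

lemma eval_in_carrier:
  assumes "is_algebra A" "range \<rho> \<subseteq> carrier A"
  shows "eval A \<rho> t \<in> carrier A"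
  using assms by (induction t) (auto simp: is_algebra_def)

lemma hom_eval:
  assumes "is_algebra A" "dqd_hom h A B" "range \<rho> \<subseteq> carrier A"
  shows "h (eval A \<rho> t) = eval B (h \<circ> \<rho>) t"
proof (induction t)
  case (Var i)
  then show ?case by simp
qed (use assms eval_in_carrier[OF assms(1,3)] in \<open>auto simp: dqd_hom_def\<close>)

lemma hom_identifies_sides:
  assumes "is_algebra A" "dqd_hom h A B" "B \<Turnstile> e" "range \<rho> \<subseteq> carrier A"
  shows "h (eval A \<rho> (fst e)) = h (eval A \<rho> (snd e))"
proof -
  have "range (h \<circ> \<rho>) \<subseteq> carrier B"
    using assms by (auto simp: dqd_hom_def)
  then show ?thesis
    using assms(3) unfolding hom_eval[OF assms(1,2,4)] satisfies_def by blast
qed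

lemma satisfies_if_separated:
  assumes A: "is_algebra A"
    and sep: "\<And>x y. x \<in> carrier A \<Longrightarrow> y \<in> carrier A \<Longrightarrow> x \<noteq> y \<Longrightarrow>
      (\<exists>h. dqd_hom h A B \<and> B \<Turnstile> e \<and> h x \<noteq> h y) \<or> (\<exists>h. dqd_hom h A B' \<and> B' \<Turnstile> e \<and> h x \<noteq> h y)"
  shows "A \<Turnstile> e"
  unfolding satisfies_def
proof (intro allI impI)
  fix \<rho> :: "nat \<Rightarrow> 'a" assume \<rho>: "range \<rho> \<subseteq> carrier A"
  show "eval A \<rho> (fst e) = eval A \<rho> (snd e)"
    using sep[OF eval_in_carrier[OF A \<rho>] eval_in_carrier[OF A \<rho>], of "fst e" "snd e"]
      hom_identifies_sides[OF A, of _ B e \<rho>] hom_identifies_sides[OF A, of _ B' e \<rho>] \<rho> by blast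
qed

lemma satisfies_if_embeds:
  assumes "is_algebra A" "dqd_hom h A B" "inj_on h (carrier A)" "B \<Turnstile> e"
  shows "A \<Turnstile> e"
  by (rule satisfies_if_separated[of A B e B]) (use assms in \<open>auto dest: inj_onD\<close>)

lemma satisfies_image:
  fixes A :: "'a dqd_struct" and B :: "'b dqd_struct"
  assumes A: "is_algebra A" and h: "dqd_hom h A B" "h ` carrier A = carrier B" and e: "A \<Turnstile> e"
  shows "B \<Turnstile> e"
  unfolding satisfies_def
proof (intro allI impI)
  fix \<sigma> :: "nat \<Rightarrow> 'b" assume \<sigma>: "range \<sigma> \<subseteq> carrier B"
  define \<rho> where "\<rho> i = inv_into (carrier A) h (\<sigma> i)" for i
  have im: "\<sigma> i \<in> h ` carrier A" for i
    using \<sigma> h(2) by auto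
  have \<rho>: "range \<rho> \<subseteq> carrier A" "h \<circ> \<rho> = \<sigma>"
    using inv_into_into[OF im] f_inv_into_f[OF im] by (auto simp: \<rho>_def)
  then show "eval B \<sigma> (fst e) = eval B \<sigma> (snd e)"
    using e hom_eval[OF A h(1) \<rho>(1)] by (metis satisfies_def)
qed

lemma is_algebra_image:
  assumes A: "is_algebra A" and h: "dqd_hom h A B" "h ` carrier A = carrier B"
  shows "is_algebra B"
  using A h(1) unfolding is_algebra_def h(2)[symmetric] dqd_hom_def
  by (auto simp: ball_simps h(2)[symmetric]) (metis imageI)+

text \<open>The algebra \<open>A\<close> with \<open>r\<close> applied to each element and each result of an operation.  If
  \<open>r\<close> picks a representative of each class of a congruence, this is the quotient algebra, and if
  \<open>r\<close> has the left inverse \<open>s\<close> it is a copy of \<open>A\<close>.\<close>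

definition image_algebra :: "('a \<Rightarrow> 'b) \<Rightarrow> ('b \<Rightarrow> 'a) \<Rightarrow> 'a dqd_struct \<Rightarrow> 'b dqd_struct" where
  "image_algebra r s A = \<lparr> carrier = r ` carrier A,
     join = (\<lambda>x y. r (join A (s x) (s y))), meet = (\<lambda>x y. r (meet A (s x) (s y))),
     imp = (\<lambda>x y. r (imp A (s x) (s y))), dual = (\<lambda>x. r (dual A (s x))),
     zero = r (zero A), one = r (one A) \<rparr>"

lemma finite_algebra_copy:
  fixes K :: "'b dqd_struct"
  assumes "is_algebra K" "finite (carrier K)"
  obtains K' :: "'a::infinite dqd_struct"
  where "is_algebra K'" "\<And>e. (K' \<Turnstile> e) \<longleftrightarrow> (K \<Turnstile> e)"
proof -
  obtain T :: "'a set" where T: "finite T" "card T = card (carrier K)"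
    using infinite_arbitrarily_large[OF infinite_UNIV] by blast
  then obtain f where f: "bij_betw f (carrier K) T"
    using finite_same_card_bij assms(2) by metis
  define K' where "K' = image_algebra f (inv_into (carrier K) f) K"
  have hom: "dqd_hom f K K'" and im: "f ` carrier K = carrier K'"
    using f by (auto simp: dqd_hom_def K'_def image_algebra_def bij_betw_def)
  show thesis
  proof
    show "is_algebra K'"
      using is_algebra_image[OF assms(1) hom im] .
    show "K' \<Turnstile> e \<longleftrightarrow> K \<Turnstile> e" for e
      using satisfies_image[OF assms(1) hom im] satisfies_if_embeds[OF assms(1) hom]
        bij_betw_imp_inj_on[OF f] by blast
  qed
qed

lemma variety_of_singleton:
  assumes "is_algebra K"
  shows "variety_of {K} = models {e. K \<Turnstile> e}"
  using assms unfolding variety_of_def models_def by blast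

text \<open>Finiteness ensures that a copy of each generator lives on the type of the join.\<close>

lemma variety_join_eq:
  fixes K :: "'b dqd_struct" and M :: "'c dqd_struct"
  assumes "is_algebra K" "finite (carrier K)" "is_algebra M" "finite (carrier M)"
  shows "(variety_of {K} \<squnion>\<^sub>V variety_of {M} :: 'a::infinite dqd_struct set) =
    models {e. K \<Turnstile> e \<and> M \<Turnstile> e}"
proof -
  obtain K' :: "'a dqd_struct" where K': "is_algebra K'" "\<And>e. K' \<Turnstile> e \<longleftrightarrow> K \<Turnstile> e"
    using finite_algebra_copy[OF assms(1,2)] by blast
  obtain M' :: "'a dqd_struct" where M': "is_algebra M'" "\<And>e. M' \<Turnstile> e \<longleftrightarrow> M \<Turnstile> e"
    using finite_algebra_copy[OF assms(3,4)] by blast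
  have mem: "K' \<in> variety_of {K}" "M' \<in> variety_of {M}"
    using K' M' by (auto simp: variety_of_singleton[OF assms(1)] variety_of_singleton[OF assms(3)] models_def)
  have sub: "variety_of {K} \<subseteq> (models {e. K \<Turnstile> e \<and> M \<Turnstile> e} :: 'a dqd_struct set)"
    "variety_of {M} \<subseteq> (models {e. K \<Turnstile> e \<and> M \<Turnstile> e} :: 'a dqd_struct set)"
    using assms by (auto simp: variety_of_singleton models_def)
  have "models {e. K \<Turnstile> e \<and> M \<Turnstile> e} \<subseteq> (models \<Sigma> :: 'a dqd_struct set)"
    if "variety_of {K} \<subseteq> (models \<Sigma> :: 'a dqd_struct set)"
      "variety_of {M} \<subseteq> (models \<Sigma> :: 'a dqd_struct set)" for \<Sigma>
  proof -
    have "K' \<in> models \<Sigma>" "M' \<in> models \<Sigma>"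
      using that mem by auto
    then show ?thesis
      using K'(2) M'(2) by (auto simp: models_def)
  qed
  then show ?thesis
    using sub unfolding variety_join_def by blast
qed


section \<open>Arithmetic of DQD-algebras\<close>

text \<open>The lattice order is expressed as \<open>x \<sqinter> y = x\<close>; \<open>x\<^sup>d\<close> is the dual operation and \<open>\<sim> x\<close> the
  pseudocomplement.\<close>

locale dqd =
  fixes A :: "'a dqd_struct"
  assumes in_DQD: "A \<in> DQD"
begin

abbreviation L :: "'a set" where "L \<equiv> carrier A"
abbreviation jn (infixl "\<squnion>" 65) where "x \<squnion> y \<equiv> join A x y"
abbreviation mt (infixl "\<sqinter>" 70) where "x \<sqinter> y \<equiv> meet A x y"
abbreviation im (infixr "\<rightarrow>" 60) where "x \<rightarrow> y \<equiv> imp A x y"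
abbreviation dl ("_\<^sup>d" [1000] 1000) where "x\<^sup>d \<equiv> dual A x"
abbreviation bt ("\<bottom>") where "\<bottom> \<equiv> zero A"
abbreviation tp ("\<top>") where "\<top> \<equiv> one A"
abbreviation pc ("\<sim> _" [90] 90) where "\<sim> x \<equiv> imp A x (zero A)"
abbreviation le (infix "\<sqsubseteq>" 50) where "x \<sqsubseteq> y \<equiv> x \<sqinter> y = x"

lemma algebra: "is_algebra A"
  using in_DQD by (simp add: DQD_def models_def)

lemma closed [simp, intro]:
  "\<bottom> \<in> L" "\<top> \<in> L" "x \<in> L \<Longrightarrow> x\<^sup>d \<in> L"
  "x \<in> L \<Longrightarrow> y \<in> L \<Longrightarrow> x \<squnion> y \<in> L"
  "x \<in> L \<Longrightarrow> y \<in> L \<Longrightarrow> x \<sqinter> y \<in> L"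
  "x \<in> L \<Longrightarrow> y \<in> L \<Longrightarrow> x \<rightarrow> y \<in> L"
  using algebra by (auto simp: is_algebra_def)

lemma instance_of_identity:
  assumes "A \<Turnstile> e" "x \<in> L" "y \<in> L" "z \<in> L"
  defines "\<rho> \<equiv> \<lambda>i::nat. if i = 0 then x else if i = 1 then y else z"
  shows "eval A \<rho> (fst e) = eval A \<rho> (snd e)"
proof -
  have "range \<rho> \<subseteq> L"
    using assms(2-4) by (auto simp: \<rho>_def)
  then show ?thesis
    using assms(1) by (simp add: satisfies_def)
qed

lemma DQD_identity: "e \<in> DQD_ids \<Longrightarrow> A \<Turnstile> e"
  using in_DQD by (simp add: DQD_def models_def)

lemmas DQD_instance = instance_of_identity[OF DQD_identity]

lemma lattice_laws:
  assumes [simp]: "x \<in> L" "y \<in> L"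
  shows join_comm: "x \<squnion> y = y \<squnion> x" and meet_comm: "x \<sqinter> y = y \<sqinter> x"
    and join_absorb: "x \<squnion> (x \<sqinter> y) = x" and meet_absorb: "x \<sqinter> (x \<squnion> y) = x"
  using DQD_instance[of "vx \<^bold>\<or> vy \<approx> vy \<^bold>\<or> vx" x y y]
    DQD_instance[of "vx \<^bold>\<and> vy \<approx> vy \<^bold>\<and> vx" x y y]
    DQD_instance[of "vx \<^bold>\<or> (vx \<^bold>\<and> vy) \<approx> vx" x y y]
    DQD_instance[of "vx \<^bold>\<and> (vx \<^bold>\<or> vy) \<approx> vx" x y y]
  by (simp_all add: DQD_ids_def semi_heyting_ids_def bounded_lattice_ids_def)

lemma assoc_laws:
  assumes [simp]: "x \<in> L" "y \<in> L" "z \<in> L"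
  shows join_assoc: "(x \<squnion> y) \<squnion> z = x \<squnion> (y \<squnion> z)" and meet_assoc: "(x \<sqinter> y) \<sqinter> z = x \<sqinter> (y \<sqinter> z)"
  using DQD_instance[of "(vx \<^bold>\<or> vy) \<^bold>\<or> vz \<approx> vx \<^bold>\<or> (vy \<^bold>\<or> vz)" x y z]
    DQD_instance[of "(vx \<^bold>\<and> vy) \<^bold>\<and> vz \<approx> vx \<^bold>\<and> (vy \<^bold>\<and> vz)" x y z]
  by (simp_all add: DQD_ids_def semi_heyting_ids_def bounded_lattice_ids_def)

lemma unit_laws:
  assumes [simp]: "x \<in> L"
  shows join_bot: "x \<squnion> \<bottom> = x" and meet_top: "x \<sqinter> \<top> = x" and imp_self: "x \<rightarrow> x = \<top>"
  using DQD_instance[of "vx \<^bold>\<or> Zero \<approx> vx" x x x] DQD_instance[of "vx \<^bold>\<and> One \<approx> vx" x x x]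
    DQD_instance[of "(vx \<^bold>\<rightarrow> vx) \<approx> One" x x x]
  by (simp_all add: DQD_ids_def semi_heyting_ids_def bounded_lattice_ids_def)

lemma meet_imp:
  assumes [simp]: "x \<in> L" "y \<in> L"
  shows "x \<sqinter> (x \<rightarrow> y) = x \<sqinter> y"
  using DQD_instance[of "vx \<^bold>\<and> (vx \<^bold>\<rightarrow> vy) \<approx> vx \<^bold>\<and> vy" x y y]
  by (simp add: DQD_ids_def semi_heyting_ids_def)

lemma meet_imp_relativize:
  assumes [simp]: "x \<in> L" "y \<in> L" "z \<in> L"
  shows "x \<sqinter> (y \<rightarrow> z) = x \<sqinter> ((x \<sqinter> y) \<rightarrow> (x \<sqinter> z))"
  using DQD_instance[of "vx \<^bold>\<and> (vy \<^bold>\<rightarrow> vz) \<approx> vx \<^bold>\<and> ((vx \<^bold>\<and> vy) \<^bold>\<rightarrow> (vx \<^bold>\<and> vz))" x y z]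
  by (simp add: DQD_ids_def semi_heyting_ids_def)

lemma dual_bot: "\<bottom>\<^sup>d = \<top>" and dual_top: "\<top>\<^sup>d = \<bottom>"
  using DQD_instance[of "Dual Zero \<approx> One" \<bottom> \<bottom> \<bottom>] DQD_instance[of "Dual One \<approx> Zero" \<bottom> \<bottom> \<bottom>]
  by (simp_all add: DQD_ids_def)

lemma dual_laws:
  assumes [simp]: "x \<in> L" "y \<in> L"
  shows dual_meet: "(x \<sqinter> y)\<^sup>d = x\<^sup>d \<squnion> y\<^sup>d"
    and dual_dual_join: "(x \<squnion> y)\<^sup>d\<^sup>d = x\<^sup>d\<^sup>d \<squnion> y\<^sup>d\<^sup>d"
  using DQD_instance[of "Dual (vx \<^bold>\<and> vy) \<approx> Dual vx \<^bold>\<or> Dual vy" x y y]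
    DQD_instance[of "Dual (Dual (vx \<^bold>\<or> vy)) \<approx> Dual (Dual vx) \<^bold>\<or> Dual (Dual vy)" x y y]
  by (simp_all add: DQD_ids_def)

lemma dual_dual_le:
  assumes [simp]: "x \<in> L"
  shows "x\<^sup>d\<^sup>d \<sqsubseteq> x"
  using DQD_instance[of "Dual (Dual vx) \<^bold>\<and> vx \<approx> Dual (Dual vx)" x x x]
  by (simp add: DQD_ids_def)

lemma meet_idem: "x \<in> L \<Longrightarrow> x \<sqinter> x = x"
  by (metis closed(2,4) join_bot meet_absorb closed(1))

lemma le_antisym: "x \<sqsubseteq> y \<Longrightarrow> y \<sqsubseteq> x \<Longrightarrow> x \<in> L \<Longrightarrow> y \<in> L \<Longrightarrow> x = y"
  by (metis meet_comm)

lemma le_trans: "x \<sqsubseteq> y \<Longrightarrow> y \<sqsubseteq> z \<Longrightarrow> x \<in> L \<Longrightarrow> y \<in> L \<Longrightarrow> z \<in> L \<Longrightarrow> x \<sqsubseteq> z"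
  by (metis meet_assoc)

lemma meet_le1: "x \<in> L \<Longrightarrow> y \<in> L \<Longrightarrow> x \<sqinter> y \<sqsubseteq> x"
  by (metis closed(5) meet_assoc meet_comm meet_idem)

lemma meet_le2: "x \<in> L \<Longrightarrow> y \<in> L \<Longrightarrow> x \<sqinter> y \<sqsubseteq> y"
  by (metis meet_assoc meet_idem)

lemma meet_greatest: "z \<sqsubseteq> x \<Longrightarrow> z \<sqsubseteq> y \<Longrightarrow> x \<in> L \<Longrightarrow> y \<in> L \<Longrightarrow> z \<in> L \<Longrightarrow> z \<sqsubseteq> x \<sqinter> y"
  by (metis meet_assoc)

lemma le_iff_join: "x \<in> L \<Longrightarrow> y \<in> L \<Longrightarrow> x \<sqsubseteq> y \<longleftrightarrow> x \<squnion> y = y"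
  by (metis join_absorb join_comm meet_absorb meet_comm)

lemma join_ge1: "x \<in> L \<Longrightarrow> y \<in> L \<Longrightarrow> x \<sqsubseteq> x \<squnion> y"
  by (simp add: meet_absorb)

lemma join_ge2: "x \<in> L \<Longrightarrow> y \<in> L \<Longrightarrow> y \<sqsubseteq> x \<squnion> y"
  by (metis join_comm meet_absorb)

lemma join_least: "x \<sqsubseteq> z \<Longrightarrow> y \<sqsubseteq> z \<Longrightarrow> x \<in> L \<Longrightarrow> y \<in> L \<Longrightarrow> z \<in> L \<Longrightarrow> x \<squnion> y \<sqsubseteq> z"
  by (metis closed(4) join_assoc le_iff_join)

lemma bounds [simp]:
  assumes "x \<in> L"
  shows "x \<squnion> \<bottom> = x" "\<bottom> \<squnion> x = x" "x \<sqinter> \<top> = x" "\<top> \<sqinter> x = x"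
    "x \<sqinter> \<bottom> = \<bottom>" "\<bottom> \<sqinter> x = \<bottom>" "x \<squnion> \<top> = \<top>" "\<top> \<squnion> x = \<top>"
proof -
  show 1: "x \<squnion> \<bottom> = x" and 2: "x \<sqinter> \<top> = x"
    using assms by (simp_all add: join_bot meet_top)
  then show 3: "\<bottom> \<squnion> x = x" and 4: "\<top> \<sqinter> x = x"
    using assms join_comm meet_comm by auto
  show 5: "\<bottom> \<sqinter> x = \<bottom>" and 6: "\<top> \<squnion> x = \<top>"
    using 2 3 4 assms meet_absorb[of \<bottom> x] join_absorb[of \<top> x] by auto
  then show "x \<sqinter> \<bottom> = \<bottom>" and "x \<squnion> \<top> = \<top>"
    using assms join_comm meet_comm by (metis closed(1,2))+
qed

text \<open>The residuation property that survives in semi-Heyting algebras; it yields distributivity.\<close>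

lemma residuation:
  assumes "x \<in> L" "y \<in> L" "z \<in> L"
  shows "x \<sqinter> y \<sqsubseteq> z \<longleftrightarrow> y \<sqsubseteq> (x \<rightarrow> (x \<sqinter> z))"
proof
  assume le: "x \<sqinter> y \<sqsubseteq> z"
  have "y \<sqinter> (x \<rightarrow> (x \<sqinter> z)) = y \<sqinter> ((y \<sqinter> x) \<rightarrow> (y \<sqinter> (x \<sqinter> z)))"
    using assms by (intro meet_imp_relativize) auto
  also have "y \<sqinter> (x \<sqinter> z) = y \<sqinter> x"
    using assms le by (metis meet_assoc meet_comm)
  finally show "y \<sqsubseteq> (x \<rightarrow> (x \<sqinter> z))"
    using assms by (simp add: imp_self)
next
  assume le: "y \<sqsubseteq> (x \<rightarrow> (x \<sqinter> z))"
  have "x \<sqinter> y = x \<sqinter> (x \<rightarrow> (x \<sqinter> z)) \<sqinter> y"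
    using assms le by (metis closed(5,6) meet_assoc meet_comm)
  also have "x \<sqinter> (x \<rightarrow> (x \<sqinter> z)) = x \<sqinter> z"
    using assms by (metis closed(5) meet_assoc meet_idem meet_imp)
  finally show "x \<sqinter> y \<sqsubseteq> z"
    using assms by (metis closed(5) meet_assoc meet_comm meet_idem)
qed

lemma meet_join_distrib:
  assumes [simp]: "x \<in> L" "y \<in> L" "z \<in> L"
  shows "x \<sqinter> (y \<squnion> z) = (x \<sqinter> y) \<squnion> (x \<sqinter> z)"
proof (rule le_antisym)
  let ?w = "(x \<sqinter> y) \<squnion> (x \<sqinter> z)"
  have "y \<squnion> z \<sqsubseteq> (x \<rightarrow> (x \<sqinter> ?w))"
    using residuation[of x y ?w] residuation[of x z ?w] join_ge1[of "x \<sqinter> y" "x \<sqinter> z"]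
      join_ge2[of "x \<sqinter> y" "x \<sqinter> z"] by (intro join_least) auto
  then show "x \<sqinter> (y \<squnion> z) \<sqsubseteq> ?w"
    using residuation[of x "y \<squnion> z" ?w] by simp
  have "x \<sqinter> u \<sqsubseteq> x \<sqinter> (y \<squnion> z)" if "u \<in> L" "u \<sqsubseteq> y \<squnion> z" for u
    using that by (intro meet_greatest meet_le1 le_trans[OF meet_le2 that(2)]) auto
  then show "?w \<sqsubseteq> x \<sqinter> (y \<squnion> z)"
    by (intro join_least) (auto simp: join_ge1 join_ge2)
qed auto

lemma join_meet_distrib:
  "x \<in> L \<Longrightarrow> y \<in> L \<Longrightarrow> z \<in> L \<Longrightarrow> (y \<squnion> z) \<sqinter> x = (y \<sqinter> x) \<squnion> (z \<sqinter> x)"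
  using meet_join_distrib[of x y z] by (simp add: meet_comm)

lemma dual_antimono: "x \<sqsubseteq> y \<Longrightarrow> x \<in> L \<Longrightarrow> y \<in> L \<Longrightarrow> y\<^sup>d \<sqsubseteq> x\<^sup>d"
  by (metis closed(3) dual_meet join_ge2)

lemma dual_dual_dual: "x \<in> L \<Longrightarrow> x\<^sup>d\<^sup>d\<^sup>d = x\<^sup>d"
  by (metis closed(3) dual_antimono dual_dual_le le_antisym)

lemma dual_eq_bot_iff: "x \<in> L \<Longrightarrow> x\<^sup>d = \<bottom> \<longleftrightarrow> x = \<top>"
  by (metis bounds(4) dual_bot dual_dual_le dual_top)

lemma imp_eq_top_imp_le: "x \<rightarrow> y = \<top> \<Longrightarrow> x \<in> L \<Longrightarrow> y \<in> L \<Longrightarrow> x \<sqsubseteq> y"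
  by (metis bounds(3) meet_imp)

lemma top_imp: "x \<in> L \<Longrightarrow> \<top> \<rightarrow> x = x"
  by (metis bounds(4) closed(2,6) meet_imp)

lemma le_pseudocompl_iff:
  assumes "x \<in> L" "y \<in> L"
  shows "x \<sqsubseteq> \<sim> y \<longleftrightarrow> x \<sqinter> y = \<bottom>"
  using residuation[of y x \<bottom>] assms by (metis bounds(5) closed(1,5) meet_comm)

lemma pseudocompl_eq_complement:
  assumes [simp]: "x \<in> L" "y \<in> L" and "x \<sqinter> y = \<bottom>" "x \<squnion> y = \<top>"
  shows "x \<rightarrow> \<bottom> = y"
proof (rule le_antisym)
  have "(x \<rightarrow> \<bottom>) \<sqinter> x = \<bottom>"
    using le_pseudocompl_iff[of "x \<rightarrow> \<bottom>" x] by (simp add: meet_idem)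
  then have "(x \<rightarrow> \<bottom>) \<sqinter> (x \<squnion> y) = (x \<rightarrow> \<bottom>) \<sqinter> y"
    by (simp add: meet_join_distrib)
  then show "(x \<rightarrow> \<bottom>) \<sqsubseteq> y"
    using assms(4) by simp
  show "y \<sqsubseteq> (x \<rightarrow> \<bottom>)"
    using assms(3) meet_comm[of x y] by (simp add: le_pseudocompl_iff)
qed auto

end

section \<open>Central elements and simple quotients of JIDL1-algebras\<close>

locale jidl = dqd +
  assumes in_JIDL1: "A \<in> JIDL1"
begin

lemma dual_join_imp:
  assumes [simp]: "x \<in> L" "y \<in> L" "z \<in> L"
  shows "x\<^sup>d \<squnion> (y \<rightarrow> z) = (x\<^sup>d \<squnion> y) \<rightarrow> (x\<^sup>d \<squnion> z)"
proof -
  have "A \<Turnstile> Dual vx \<^bold>\<or> (vy \<^bold>\<rightarrow> vz) \<approx> ((Dual vx \<^bold>\<or> vy) \<^bold>\<rightarrow> (Dual vx \<^bold>\<or> vz))"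
    using in_JIDL1 by (simp add: JIDL1_def models_def)
  from instance_of_identity[OF this assms] show ?thesis
    by simp
qed

lemma prelinear:
  assumes [simp]: "x \<in> L" "y \<in> L"
  shows "(x \<rightarrow> y) \<squnion> (y \<rightarrow> x) = \<top>"
proof -
  have "A \<Turnstile> (vx \<^bold>\<rightarrow> vy) \<^bold>\<or> (vy \<^bold>\<rightarrow> vx) \<approx> One"
    using in_JIDL1 by (simp add: JIDL1_def models_def)
  from instance_of_identity[OF this assms assms(2)] show ?thesis
    by simp
qed

lemma level1:
  assumes [simp]: "x \<in> L"
  shows "\<sim> (x \<sqinter> \<sim> x\<^sup>d)\<^sup>d = x \<sqinter> \<sim> x\<^sup>d"
proof -
  have "A \<Turnstile> vx \<^bold>\<and> star (Dual vx) \<approx> star (Dual (vx \<^bold>\<and> star (Dual vx)))"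
    using in_JIDL1 by (simp add: JIDL1_def models_def)
  from instance_of_identity[OF this assms assms assms] show ?thesis
    by (simp only: eval.simps fst_conv snd_conv refl if_True)
qed

text \<open>Every element of the form \<open>x'\<close> is complemented.\<close>

lemma dual_complemented:
  assumes [simp]: "x \<in> L"
  shows "x\<^sup>d \<sqinter> \<sim> x\<^sup>d = \<bottom>" "x\<^sup>d \<squnion> \<sim> x\<^sup>d = \<top>"
proof -
  have idem: "x\<^sup>d \<squnion> x\<^sup>d = x\<^sup>d"
    using le_iff_join[of "x\<^sup>d" "x\<^sup>d"] by (simp add: meet_idem)
  show "x\<^sup>d \<squnion> \<sim> x\<^sup>d = \<top>"
    by (subst dual_join_imp) (simp_all add: idem imp_self)
  show "x\<^sup>d \<sqinter> \<sim> x\<^sup>d = \<bottom>"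
    by (simp add: meet_imp)
qed

text \<open>The central elements, at which the algebra splits as a direct product.\<close>

definition central :: "'a set" where
  "central = {e \<in> L. \<sim> e\<^sup>d = e}"

lemma central_in [simp]: "e \<in> central \<Longrightarrow> e \<in> L"
  and centralD: "e \<in> central \<Longrightarrow> \<sim> e\<^sup>d = e"
  and centralI: "\<sim> e\<^sup>d = e \<Longrightarrow> e \<in> L \<Longrightarrow> e \<in> central"
  unfolding central_def by blast+

lemma level_central: "x \<in> L \<Longrightarrow> x \<sqinter> \<sim> x\<^sup>d \<in> central"
  by (intro centralI level1) simp_all

lemma central_complement:
  assumes "e \<in> central"
  shows "e\<^sup>d \<sqinter> e = \<bottom>" "e\<^sup>d \<squnion> e = \<top>" "e \<sqinter> e\<^sup>d = \<bottom>" "e \<squnion> e\<^sup>d = \<top>"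
proof -
  show 1: "e\<^sup>d \<sqinter> e = \<bottom>" and 2: "e\<^sup>d \<squnion> e = \<top>"
    using dual_complemented[of e] assms by (simp_all add: centralD)
  have [simp]: "e \<in> L"
    using assms by simp
  show "e \<sqinter> e\<^sup>d = \<bottom>"
    by (subst meet_comm) (simp_all add: 1)
  show "e \<squnion> e\<^sup>d = \<top>"
    by (subst join_comm) (simp_all add: 2)
qed

lemma central_dual:
  assumes e: "e \<in> central"
  shows "e\<^sup>d \<in> central"
proof -
  have [simp]: "e \<in> L"
    using e by simp
  note compl = central_complement[OF e]
  have "e\<^sup>d \<squnion> e\<^sup>d\<^sup>d = (e \<sqinter> e\<^sup>d)\<^sup>d"
    by (simp add: dual_meet)
  then have top: "e\<^sup>d \<squnion> e\<^sup>d\<^sup>d = \<top>"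
    by (simp add: compl dual_bot)
  have "e \<sqinter> (e\<^sup>d \<squnion> e\<^sup>d\<^sup>d) = e \<sqinter> e\<^sup>d\<^sup>d"
    by (simp add: meet_join_distrib compl)
  then have "e \<sqsubseteq> e\<^sup>d\<^sup>d"
    by (simp add: top)
  then have "e\<^sup>d\<^sup>d = e"
    using dual_dual_le[of e] le_antisym[of e "e\<^sup>d\<^sup>d"] by simp
  moreover have "\<sim> e = e\<^sup>d"
    by (rule pseudocompl_eq_complement) (simp_all add: compl)
  ultimately have "\<sim> e\<^sup>d\<^sup>d = e\<^sup>d"
    by (simp only:)
  then show ?thesis
    by (simp add: centralI)
qed

lemma central_top: "\<top> \<in> central"
  by (simp add: centralI dual_top imp_self)

lemma central_meet:
  assumes e: "e \<in> central" and f: "f \<in> central"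
  shows "e \<sqinter> f \<in> central"
proof -
  have L [simp]: "e \<in> L" "f \<in> L"
    using e f by simp_all
  define x where "x = e\<^sup>d \<squnion> f\<^sup>d"
  have x [simp]: "x \<in> L"
    by (simp add: x_def)
  have below: "\<sim> x \<sqsubseteq> g" if g: "g \<in> central" "g\<^sup>d \<sqsubseteq> x" for g
  proof -
    have [simp]: "g \<in> L"
      using g(1) by simp
    have "\<sim> x \<sqinter> x = \<bottom>"
      using le_pseudocompl_iff[of "\<sim> x" x] by (simp add: meet_idem)
    moreover have "\<sim> x \<sqinter> g\<^sup>d = \<sim> x \<sqinter> x \<sqinter> g\<^sup>d"
      using g(2) by (simp add: meet_assoc meet_comm[of x "g\<^sup>d"])
    ultimately have "\<sim> x \<sqinter> g\<^sup>d = \<bottom>"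
      by simp
    then have "\<sim> x \<sqsubseteq> \<sim> g\<^sup>d"
      by (simp add: le_pseudocompl_iff)
    then show ?thesis
      using g(1) by (simp add: centralD)
  qed
  have "\<sim> x \<sqsubseteq> e \<sqinter> f"
    by (intro meet_greatest below e f) (simp_all add: x_def join_ge1 join_ge2)
  moreover have "e \<sqinter> f \<sqinter> e\<^sup>d = e \<sqinter> e\<^sup>d \<sqinter> f"
    by (simp add: meet_assoc meet_comm[of f "e\<^sup>d"])
  then have "e \<sqinter> f \<sqinter> e\<^sup>d = \<bottom>" "e \<sqinter> f \<sqinter> f\<^sup>d = \<bottom>"
    by (simp_all add: meet_assoc central_complement[OF e] central_complement[OF f])
  then have "e \<sqinter> f \<sqsubseteq> \<sim> x"
    by (simp add: le_pseudocompl_iff x_def meet_join_distrib)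
  ultimately have "\<sim> x = e \<sqinter> f"
    using le_antisym[of "\<sim> x" "e \<sqinter> f"] by simp
  then show ?thesis
    by (simp add: centralI dual_meet x_def)
qed

text \<open>An ultrafilter of central elements at none of which \<open>a\<close> and \<open>b\<close> agree.  Zorn's lemma is applied
  to the sets closed under meets with this property, without asking for upward closure; a maximal
  one decides each central element.\<close>

lemma separating_ultrafilter:
  assumes a [simp]: "a \<in> L" and b [simp]: "b \<in> L" and "a \<noteq> b"
  obtains U where "U \<subseteq> central" "\<top> \<in> U" "\<And>e f. e \<in> U \<Longrightarrow> f \<in> U \<Longrightarrow> e \<sqinter> f \<in> U"
    "\<And>e. e \<in> central \<Longrightarrow> e \<in> U \<or> e\<^sup>d \<in> U" "\<And>e. e \<in> U \<Longrightarrow> a \<sqinter> e \<noteq> b \<sqinter> e"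
proof -
  define \<F> where "\<F> = {U. U \<subseteq> central \<and> \<top> \<in> U \<and> (\<forall>e\<in>U. \<forall>f\<in>U. e \<sqinter> f \<in> U) \<and>
    (\<forall>e\<in>U. a \<sqinter> e \<noteq> b \<sqinter> e)}"
  have \<F>I: "X \<in> \<F>" if "\<And>e. e \<in> X \<Longrightarrow> e \<in> central" "\<top> \<in> X"
    "\<And>e f. e \<in> X \<Longrightarrow> f \<in> X \<Longrightarrow> e \<sqinter> f \<in> X" "\<And>e. e \<in> X \<Longrightarrow> a \<sqinter> e \<noteq> b \<sqinter> e" for X
    unfolding \<F>_def using that by blast
  have \<F>D: "\<And>e. e \<in> X \<Longrightarrow> e \<in> central" "\<top> \<in> X"
    "\<And>e f. e \<in> X \<Longrightarrow> f \<in> X \<Longrightarrow> e \<sqinter> f \<in> X" "\<And>e. e \<in> X \<Longrightarrow> a \<sqinter> e \<noteq> b \<sqinter> e"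
    if "X \<in> \<F>" for X
    using that unfolding \<F>_def by blast+
  have "\<exists>U\<in>\<F>. \<forall>X\<in>\<F>. U \<subseteq> X \<longrightarrow> X = U"
  proof (rule subset_Zorn_nonempty)
    have "{\<top>} \<in> \<F>"
      using assms by (intro \<F>I) (auto simp: central_top)
    then show "\<F> \<noteq> {}"
      by blast
    fix \<C> assume ne: "\<C> \<noteq> {}" and "subset.chain \<F> \<C>"
    then have sub: "\<C> \<subseteq> \<F>" and ch: "\<And>X Y. X \<in> \<C> \<Longrightarrow> Y \<in> \<C> \<Longrightarrow> X \<subseteq> Y \<or> Y \<subseteq> X"
      by (auto simp: subset_chain_def)
    have "e \<sqinter> f \<in> \<Union>\<C>" if ef: "e \<in> \<Union>\<C>" "f \<in> \<Union>\<C>" for e f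
    proof -
      obtain X where "X \<in> \<C>" "e \<in> X" "f \<in> X"
        using ef ch by blast
      then show ?thesis
        using sub \<F>D(3) by blast
    qed
    moreover have "\<top> \<in> \<Union>\<C>"
      using ne sub \<F>D(2) by blast
    ultimately show "\<Union>\<C> \<in> \<F>"
      using sub \<F>D(1,4) by (intro \<F>I) blast+
  qed
  then obtain U where U: "U \<in> \<F>" and max: "\<And>X. X \<in> \<F> \<Longrightarrow> U \<subseteq> X \<Longrightarrow> X = U"
    by blast
  have UL [simp]: "e \<in> L" if "e \<in> U" for e
    using \<F>D(1)[OF U that] by simp
  have collapse: "\<exists>e\<in>U. a \<sqinter> e \<sqinter> s = b \<sqinter> e \<sqinter> s" if s: "s \<in> central" "s \<notin> U" for s
  proof (rule ccontr)
    assume neg: "\<not> ?thesis"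
    \<comment> \<open>the set obtained by adjoining \<open>s\<close> to \<open>U\<close>\<close>
    let ?X = "U \<union> {e \<sqinter> s |e. e \<in> U}"
    have [simp]: "s \<in> L"
      using s by simp
    have "x \<sqinter> y \<in> ?X" if xy: "x \<in> ?X" "y \<in> ?X" for x y
    proof -
      have ex: "\<exists>e\<in>U. x = e \<or> x = e \<sqinter> s" "\<exists>f\<in>U. y = f \<or> y = f \<sqinter> s"
        using xy by auto
      then obtain e f where ef: "e \<in> U" "f \<in> U" "x = e \<or> x = e \<sqinter> s" "y = f \<or> y = f \<sqinter> s"
        by blast
      then have [simp]: "e \<in> L" "f \<in> L"
        by simp_all
      have "x \<sqinter> y = e \<sqinter> f \<or> x \<sqinter> y = e \<sqinter> f \<sqinter> s"
        using ef(3,4) meet_assoc[of e f s] meet_assoc[of e s f] meet_assoc[of e s "f \<sqinter> s"]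
          meet_assoc[of s f s] meet_assoc[of f s s] meet_comm[of s f] by (auto simp: meet_idem)
      moreover have "e \<sqinter> f \<in> U"
        using \<F>D(3)[OF U ef(1,2)] .
      then have "e \<sqinter> f \<in> ?X" "e \<sqinter> f \<sqinter> s \<in> ?X"
        by blast+
      ultimately show ?thesis
        by (elim disjE) (simp_all only:)
    qed
    moreover have "a \<sqinter> x \<noteq> b \<sqinter> x" if x: "x \<in> ?X" for x
    proof (cases "x \<in> U")
      case True
      then show ?thesis
        using \<F>D(4)[OF U] by simp
    next
      case False
      then obtain e where "e \<in> U" "x = e \<sqinter> s"
        using x by blast
      then show ?thesis
        using neg meet_assoc[of a e s] meet_assoc[of b e s] by auto
    qed
    moreover have "x \<in> central" if "x \<in> ?X" for x
      using that \<F>D(1)[OF U] central_meet s(1) by blast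
    moreover have "\<top> \<in> ?X" "\<top> \<sqinter> s \<in> ?X"
      using \<F>D(2)[OF U] by blast+
    ultimately have "?X \<in> \<F>"
      by (intro \<F>I) blast+
    then have "?X = U"
      using max by blast
    then show False
      using \<open>\<top> \<sqinter> s \<in> ?X\<close> s(2) by simp
  qed
  have "e \<in> U \<or> e\<^sup>d \<in> U" if e: "e \<in> central" for e
  proof (rule ccontr)
    assume "\<not> ?thesis"
    then obtain p q where pq: "p \<in> U" "q \<in> U" "a \<sqinter> p \<sqinter> e = b \<sqinter> p \<sqinter> e"
      "a \<sqinter> q \<sqinter> e\<^sup>d = b \<sqinter> q \<sqinter> e\<^sup>d"
      using collapse[OF e] collapse[OF central_dual[OF e]] by blast
    have [simp]: "p \<in> L" "q \<in> L" "e \<in> L"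
      using pq e by simp_all
    \<comment> \<open>agreement at a central element and at its complement is agreement everywhere\<close>
    have split: "x \<sqinter> (p \<sqinter> q) = (x \<sqinter> q \<sqinter> e\<^sup>d \<sqinter> p) \<squnion> (x \<sqinter> p \<sqinter> e \<sqinter> q)" if [simp]: "x \<in> L" for x
    proof -
      have "x \<sqinter> (p \<sqinter> q) = x \<sqinter> (p \<sqinter> q) \<sqinter> (e\<^sup>d \<squnion> e)"
        using central_complement[OF e] by simp
      also have "\<dots> = (x \<sqinter> (p \<sqinter> q) \<sqinter> e\<^sup>d) \<squnion> (x \<sqinter> (p \<sqinter> q) \<sqinter> e)"
        by (simp add: meet_join_distrib)
      also have "x \<sqinter> (p \<sqinter> q) \<sqinter> e\<^sup>d = x \<sqinter> q \<sqinter> e\<^sup>d \<sqinter> p"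
        by (simp add: meet_assoc meet_comm[of p q] meet_comm[of p "e\<^sup>d"])
      also have "x \<sqinter> (p \<sqinter> q) \<sqinter> e = x \<sqinter> p \<sqinter> e \<sqinter> q"
        by (simp add: meet_assoc meet_comm[of q e])
      finally show ?thesis .
    qed
    have "a \<sqinter> (p \<sqinter> q) = b \<sqinter> (p \<sqinter> q)"
      using pq(3,4) by (simp add: split)
    moreover have "p \<sqinter> q \<in> U"
      using \<F>D(3)[OF U pq(1,2)] .
    ultimately show False
      using \<F>D(4)[OF U] by blast
  qed
  then show thesis
    using that[of U] \<F>D[OF U] by blast
qed

text \<open>Agreeing at some member of the ultrafilter is a congruence; modulo it the term
  \<open>x \<and> x'\<^sup>*\<close>, whose values are central, takes only the values 0 and 1.\<close>

lemma simple_quotient: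
  assumes [simp]: "a \<in> L" "b \<in> L" and "a \<noteq> b"
  obtains r and Q :: "'a dqd_struct" where "dqd_hom r A Q" "r ` L = carrier Q" "r a \<noteq> r b"
    "\<And>x. x \<in> carrier Q \<Longrightarrow> meet Q x (imp Q (dual Q x) (zero Q)) \<in> {zero Q, one Q}"
proof -
  obtain U where U: "U \<subseteq> central" "\<top> \<in> U" "\<And>e f. e \<in> U \<Longrightarrow> f \<in> U \<Longrightarrow> e \<sqinter> f \<in> U"
    "\<And>e. e \<in> central \<Longrightarrow> e \<in> U \<or> e\<^sup>d \<in> U" "\<And>e. e \<in> U \<Longrightarrow> a \<sqinter> e \<noteq> b \<sqinter> e"
    using separating_ultrafilter[OF assms] by blast
  have UL [simp]: "e \<in> L" if "e \<in> U" for e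
    using U(1) that by auto
  define R where "R x y \<longleftrightarrow> (\<exists>e\<in>U. x \<sqinter> e = y \<sqinter> e)" for x y
  have RI: "e \<in> U \<Longrightarrow> x \<sqinter> e = y \<sqinter> e \<Longrightarrow> R x y" for x y e
    unfolding R_def by blast
  have RE: "\<exists>e. e \<in> U \<and> e \<in> L \<and> x \<sqinter> e = y \<sqinter> e" if "R x y" for x y
    using that UL unfolding R_def by blast
  have R_refl: "R x x" for x
    using RI[OF U(2)] by blast
  have R_sym: "R x y \<Longrightarrow> R y x" for x y
    unfolding R_def by metis
  have common: "\<exists>e. e \<in> U \<and> e \<in> L \<and> x \<sqinter> e = y \<sqinter> e \<and> u \<sqinter> e = v \<sqinter> e"
    if R: "R x y" "R u v" and [simp]: "x \<in> L" "y \<in> L" "u \<in> L" "v \<in> L" for x y u v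
  proof -
    obtain e f where ef: "e \<in> U" "f \<in> U" "x \<sqinter> e = y \<sqinter> e" "u \<sqinter> f = v \<sqinter> f"
      and [simp]: "e \<in> L" "f \<in> L"
      using RE[OF R(1)] RE[OF R(2)] by blast
    have "x \<sqinter> (e \<sqinter> f) = y \<sqinter> (e \<sqinter> f)"
      using ef(3) by (simp flip: meet_assoc)
    moreover have "u \<sqinter> (e \<sqinter> f) = v \<sqinter> (e \<sqinter> f)"
      using ef(4) unfolding meet_comm[OF \<open>e \<in> L\<close> \<open>f \<in> L\<close>] by (simp flip: meet_assoc)
    ultimately show ?thesis
      using U(3)[OF ef(1,2)] by (intro exI[of _ "e \<sqinter> f"]) simp
  qed
  have R_trans: "R x z" if "R x y" "R y z" "x \<in> L" "y \<in> L" "z \<in> L" for x y z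
    using common[OF that(1,2,3,4,4,5)] RI by metis
  have R_join: "R (x \<squnion> u) (y \<squnion> v)" and R_meet: "R (x \<sqinter> u) (y \<sqinter> v)"
    and R_imp: "R (x \<rightarrow> u) (y \<rightarrow> v)"
    if R: "R x y" "R u v" and xyuv [simp]: "x \<in> L" "y \<in> L" "u \<in> L" "v \<in> L" for x y u v
  proof -
    obtain e where e: "e \<in> U" "x \<sqinter> e = y \<sqinter> e" "u \<sqinter> e = v \<sqinter> e" and [simp]: "e \<in> L"
      using common[OF R xyuv] by blast
    have "(x \<squnion> u) \<sqinter> e = (y \<squnion> v) \<sqinter> e"
      by (simp add: join_meet_distrib e(2,3))
    then show "R (x \<squnion> u) (y \<squnion> v)"
      by (rule RI[OF e(1)])
    have "p \<sqinter> q \<sqinter> e = (p \<sqinter> e) \<sqinter> (q \<sqinter> e)" if [simp]: "p \<in> L" "q \<in> L" for p q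
      by (simp add: meet_assoc meet_comm[of e "q \<sqinter> e"] meet_idem)
    then have "x \<sqinter> u \<sqinter> e = y \<sqinter> v \<sqinter> e"
      by (simp add: e(2,3))
    then show "R (x \<sqinter> u) (y \<sqinter> v)"
      by (rule RI[OF e(1)])
    have "(p \<rightarrow> q) \<sqinter> e = e \<sqinter> ((p \<sqinter> e) \<rightarrow> (q \<sqinter> e))" if [simp]: "p \<in> L" "q \<in> L" for p q
      unfolding meet_comm[OF that(1) \<open>e \<in> L\<close>] meet_comm[OF that(2) \<open>e \<in> L\<close>]
      by (subst meet_comm) (simp_all flip: meet_imp_relativize)
    then have "(x \<rightarrow> u) \<sqinter> e = (y \<rightarrow> v) \<sqinter> e"
      by (simp add: e(2,3))
    then show "R (x \<rightarrow> u) (y \<rightarrow> v)"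
      by (rule RI[OF e(1)])
  qed
  have R_dual: "R (x\<^sup>d) (y\<^sup>d)" if R: "R x y" and [simp]: "x \<in> L" "y \<in> L" for x y
  proof -
    obtain e where e: "e \<in> U" "x \<sqinter> e = y \<sqinter> e" and [simp]: "e \<in> L"
      using RE[OF R] by blast
    have ec: "e \<in> central"
      using U(1) e(1) by blast
    \<comment> \<open>\<open>(z \<and> e)' = z' \<or> e'\<close>, and \<open>e'\<close> is disjoint from \<open>e\<close>\<close>
    have "z\<^sup>d \<sqinter> e = (z \<sqinter> e)\<^sup>d \<sqinter> e" if [simp]: "z \<in> L" for z
      by (simp add: dual_meet join_meet_distrib central_complement[OF ec])
    then have "x\<^sup>d \<sqinter> e = y\<^sup>d \<sqinter> e"
      by (simp add: e(2))
    then show ?thesis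
      by (rule RI[OF e(1)])
  qed
  define r where "r x = (SOME y. y \<in> L \<and> R x y)" for x
  have r: "r x \<in> L" "R x (r x)" if "x \<in> L" for x
    unfolding r_def using someI[of "\<lambda>y. y \<in> L \<and> R x y" x] that R_refl by blast+
  have r_eq: "r x = r y \<longleftrightarrow> R x y" if xy: "x \<in> L" "y \<in> L" for x y
  proof
    assume "r x = r y"
    then show "R x y"
      using r[of x] r[of y] xy R_sym R_trans by metis
  next
    assume "R x y"
    then have "(\<lambda>z. z \<in> L \<and> R x z) = (\<lambda>z. z \<in> L \<and> R y z)"
      using xy R_sym R_trans by metis
    then show "r x = r y"
      by (simp add: r_def)
  qed
  define Q where "Q = image_algebra r id A"
  have hom: "dqd_hom r A Q" and im: "r ` L = carrier Q"
    using r by (auto simp: dqd_hom_def Q_def image_algebra_def r_eq R_join R_meet R_imp R_dual)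
  have "meet Q x (imp Q (dual Q x) (zero Q)) \<in> {zero Q, one Q}" if x: "x \<in> carrier Q" for x
  proof -
    obtain y where y: "y \<in> L" "x = r y"
      using x im by auto
    let ?e = "y \<sqinter> \<sim> y\<^sup>d"
    have e: "?e \<in> central" "?e \<in> L"
      using level_central[OF y(1)] by auto
    have "R ?e \<bottom> \<or> R ?e \<top>"
      using U(4)[OF e(1)]
    proof
      assume "?e \<in> U"
      moreover have "?e \<sqinter> ?e = \<top> \<sqinter> ?e"
        using e(2) by (simp only: meet_idem bounds(4))
      ultimately show ?thesis
        using RI by blast
    next
      assume "?e\<^sup>d \<in> U"
      moreover have "?e \<sqinter> ?e\<^sup>d = \<bottom> \<sqinter> ?e\<^sup>d"
        using e(2) by (simp only: central_complement(3)[OF e(1)] bounds(6) closed(3))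
      ultimately show ?thesis
        using RI by blast
    qed
    then have "r ?e \<in> {zero Q, one Q}"
      using e(2) r_eq[of ?e \<bottom>] r_eq[of ?e \<top>] by (auto simp: Q_def image_algebra_def)
    then show ?thesis
      using hom y by (simp add: dqd_hom_def)
  qed
  moreover have "r a \<noteq> r b"
    using U(5) RE[of a b] by (auto simp only: r_eq assms)
  ultimately show thesis
    using that hom im by blast
qed

end

section \<open>Finite dually Stone Heyting chains\<close>

text \<open>The \<open>n\<close>-element chain on the natural numbers below \<open>n\<close>.\<close>

definition chain_algebra :: "nat \<Rightarrow> nat dqd_struct" where
  "chain_algebra n = \<lparr> carrier = {..<n}, join = max, meet = min,
     imp = (\<lambda>i j. if i \<le> j then n - 1 else j),
     dual = (\<lambda>i. if i = n - 1 then 0 else n - 1), zero = 0, one = n - 1 \<rparr>"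

lemma chain_algebra_JIDL1:
  assumes "n \<ge> 2"
  shows "chain_algebra n \<in> JIDL1"
proof -
  have lt: "\<rho> i < n" if "range \<rho> \<subseteq> {..<n}" for \<rho> :: "nat \<Rightarrow> nat" and i
    using that by auto
  have le: "\<rho> i \<le> n - Suc 0" if "range \<rho> \<subseteq> {..<n}" for \<rho> :: "nat \<Rightarrow> nat" and i
    using lt[OF that, of i] by simp
  have top: "n - Suc 0 \<le> \<rho> i \<longleftrightarrow> \<rho> i = n - Suc 0" if "range \<rho> \<subseteq> {..<n}"
    for \<rho> :: "nat \<Rightarrow> nat" and i
    using le[OF that, of i] by auto
  show ?thesis
    using assms unfolding JIDL1_def models_def DQD_ids_def semi_heyting_ids_def
      bounded_lattice_ids_def satisfies_def is_algebra_def chain_algebra_def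
    by (auto simp: min_def max_def le top)
qed

lemma JIDL1_imp_DQD: "A \<in> JIDL1 \<Longrightarrow> A \<in> DQD"
  by (auto simp: JIDL1_def DQD_def models_def)

lemma D2_JIDL1: "D2 \<in> JIDL1"
  using D2_in_DQD unfolding DQD_def JIDL1_def models_def
  by (auto simp: satisfies_def D2_def split: prod.splits)

text \<open>The terms joined in the chain identity.\<close>

abbreviation chain_terms :: "nat \<Rightarrow> tm list" where
  "chain_terms n \<equiv> map Var [1..<n+1] @ map (\<lambda>i. Var i \<^bold>\<rightarrow> Var (i + 1)) [1..<n]"

lemma set_chain_terms:
  "set (chain_terms n) =
    {Var i |i. 1 \<le> i \<and> i \<le> n} \<union> {Var i \<^bold>\<rightarrow> Var (i + 1) |i. 1 \<le> i \<and> i < n}"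
  by auto

lemma (in dqd) le_eval_big_join:
  assumes \<rho>: "range \<rho> \<subseteq> L" and t: "t \<in> set ts"
  shows "eval A \<rho> t \<sqsubseteq> eval A \<rho> (big_join ts)"
  using t
proof (induction ts rule: big_join.induct)
  case 1
  then show ?case by simp
next
  case (2 u)
  then show ?case
    by (simp add: meet_idem eval_in_carrier[OF algebra \<rho>])
next
  case (3 u v ts)
  have [simp]: "eval A \<rho> w \<in> L" for w
    by (rule eval_in_carrier[OF algebra \<rho>])
  show ?case
  proof (cases "t = u")
    case True
    then show ?thesis
      by (simp add: join_ge1)
  next
    case False
    then have "eval A \<rho> t \<sqsubseteq> eval A \<rho> (big_join (v # ts))"
      using 3 by auto
    then have "eval A \<rho> t \<sqsubseteq> eval A \<rho> u \<squnion> eval A \<rho> (big_join (v # ts))"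
      by (rule le_trans[OF _ join_ge2]) simp_all
    then show ?thesis
      by simp
  qed
qed

lemma D2_chain_identity:
  assumes "n \<ge> 2"
  shows "D2 \<Turnstile> chain_identity n"
  unfolding satisfies_def
proof (intro allI impI)
  interpret dqd D2
    by (rule dqd.intro[OF D2_in_DQD])
  fix \<rho> :: "nat \<Rightarrow> bool \<times> bool" assume \<rho>: "range \<rho> \<subseteq> carrier D2"
  let ?j = "eval D2 \<rho> (big_join (chain_terms n))"
  have "Var 1 \<in> set (chain_terms n)" "(Var 1 \<^bold>\<rightarrow> Var 2) \<in> set (chain_terms n)"
    using assms by force+
  \<comment> \<open>in a Boolean algebra already \<open>x\<^sub>1 \<or> (x\<^sub>1 \<rightarrow> x\<^sub>2) = 1\<close>\<close>
  from this[THEN le_eval_big_join[OF \<rho>]] have "?j = one D2"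
    by (cases ?j; cases "\<rho> 1"; cases "\<rho> 2") (auto simp: D2_def)
  then show "eval D2 \<rho> (fst (chain_identity n)) = eval D2 \<rho> (snd (chain_identity n))"
    by (simp add: chain_identity_def)
qed

lemma chain_algebra_chain_identity:
  assumes "n \<ge> 2"
  shows "chain_algebra n \<Turnstile> chain_identity n"
  unfolding satisfies_def
proof (intro allI impI)
  interpret dqd "chain_algebra n"
    by (rule dqd.intro[OF JIDL1_imp_DQD[OF chain_algebra_JIDL1[OF assms]]])
  fix \<rho> :: "nat \<Rightarrow> nat" assume \<rho>: "range \<rho> \<subseteq> carrier (chain_algebra n)"
  have less: "\<rho> i < n" for i
    using \<rho> by (auto simp: chain_algebra_def)
  let ?j = "eval (chain_algebra n) \<rho> (big_join (chain_terms n))"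
  have "?j = n - 1"
  proof (rule ccontr)
    assume j: "?j \<noteq> n - 1"
    have car: "carrier (chain_algebra n) = {..<n}"
      by (simp add: chain_algebra_def)
    have "?j \<in> carrier (chain_algebra n)"
      by (rule eval_in_carrier[OF algebra \<rho>])
    then have "?j < n"
      unfolding car lessThan_iff .
    with j have lt: "?j < n - 1"
      by linarith
    have below: "eval (chain_algebra n) \<rho> t < n - 1" if "t \<in> set (chain_terms n)" for t
      using le_eval_big_join[OF \<rho> that] lt by (simp add: chain_algebra_def min_def split: if_splits)
    have var: "\<rho> i < n - 1" if "1 \<le> i" "i \<le> n" for i
    proof -
      have "Var i \<in> set (chain_terms n)"
        unfolding set_chain_terms using that by blast
      from below[OF this] show ?thesis
        by simp
    qed
    have imp: "\<rho> (i + 1) < \<rho> i" if "1 \<le> i" "i < n" for i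
    proof -
      have "(Var i \<^bold>\<rightarrow> Var (i + 1)) \<in> set (chain_terms n)"
        unfolding set_chain_terms using that by blast
      from below[OF this] show ?thesis
        by (simp add: chain_algebra_def split: if_splits)
    qed
    \<comment> \<open>the values decrease strictly from below the top, so there is no room for \<open>n\<close> of them\<close>
    have "i \<le> n \<longrightarrow> \<rho> i + i \<le> n - 1" if "1 \<le> i" for i
      using that
    proof (induction i rule: nat_induct_at_least)
      case base
      then show ?case
        using var[of 1] by auto
    next
      case (Suc i)
      then show ?case
        using imp[of i] by auto
    qed
    from this[of n] show False
      using assms by simp
  qed
  then show "eval (chain_algebra n) \<rho> (fst (chain_identity n)) =
      eval (chain_algebra n) \<rho> (snd (chain_identity n))"
    by (simp add: chain_identity_def chain_algebra_def)
qed

text \<open>Nontrivial dually Stone Heyting chains; in them every operation is determined by the order.\<close>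

locale dually_stone_chain = dqd +
  assumes chain: "dually_stone_heyting_chain A" and nontrivial: "\<bottom> \<noteq> \<top>"
begin

lemma le_total:
  assumes "x \<in> L" "y \<in> L"
  shows "x \<sqsubseteq> y \<or> y \<sqsubseteq> x"
proof -
  have "x \<sqinter> y = x \<or> x \<sqinter> y = y"
    using chain assms by (simp add: dually_stone_heyting_chain_def is_chain_def)
  then show ?thesis
    using meet_comm[OF assms] by metis
qed

lemma imp_eq:
  assumes [simp]: "x \<in> L" "y \<in> L"
  shows "x \<rightarrow> y = (if x \<sqsubseteq> y then \<top> else y)"
proof (cases "x \<sqsubseteq> y")
  case True
  have "A \<Turnstile> ((vx \<^bold>\<and> vy) \<^bold>\<rightarrow> vy) \<approx> One"
    using chain by (simp add: dually_stone_heyting_chain_def)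
  from instance_of_identity[OF this assms assms(2)] True show ?thesis
    by simp
next
  case False
  then have yx: "y \<sqsubseteq> x"
    using le_total[of x y] by simp
  have "\<not> x \<sqsubseteq> (x \<rightarrow> y)"
    using False by (simp add: meet_imp)
  then have "(x \<rightarrow> y) \<sqsubseteq> x"
    using le_total[of x "x \<rightarrow> y"] by simp
  then have "x \<rightarrow> y = x \<sqinter> (x \<rightarrow> y)"
    by (simp add: meet_comm[of x "x \<rightarrow> y"])
  also have "\<dots> = y"
    using yx by (simp add: meet_imp meet_comm[of x y])
  finally show ?thesis
    using False by simp
qed

lemma dual_eq:
  assumes [simp]: "x \<in> L"
  shows "x\<^sup>d = (if x = \<top> then \<bottom> else \<top>)"
proof (cases "x = \<top>")
  case True
  then show ?thesis
    by (simp add: dual_top)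
next
  case False
  have "A \<Turnstile> Dual vx \<^bold>\<and> Dual (Dual vx) \<approx> Zero"
    using chain by (simp add: dually_stone_heyting_chain_def)
  from instance_of_identity[OF this assms assms assms] have 1: "x\<^sup>d \<sqinter> x\<^sup>d\<^sup>d = \<bottom>"
    by simp
  have "x\<^sup>d\<^sup>d \<noteq> \<top>"
    using False dual_dual_le[of x] by auto
  then have "x\<^sup>d \<noteq> \<bottom>"
    using dual_bot by auto
  moreover have "x\<^sup>d = \<bottom> \<or> x\<^sup>d\<^sup>d = \<bottom>"
    using le_total[of "x\<^sup>d" "x\<^sup>d\<^sup>d"] 1 meet_comm[of "x\<^sup>d" "x\<^sup>d\<^sup>d"] by (metis assms closed(3))
  ultimately show ?thesis
    using False by (simp add: dual_eq_bot_iff)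
qed

lemma join_eq:
  assumes [simp]: "x \<in> L" "y \<in> L"
  shows "x \<squnion> y = (if x \<sqsubseteq> y then y else x)"
  using le_total[OF assms] le_iff_join[OF assms] le_iff_join[OF assms(2,1)] join_comm[OF assms]
  by (metis (full_types))

lemma meet_eq:
  assumes [simp]: "x \<in> L" "y \<in> L"
  shows "x \<sqinter> y = (if x \<sqsubseteq> y then x else y)"
  using le_total[OF assms] meet_comm[OF assms] by (metis (full_types))

text \<open>The number of elements of \<open>T\<close> strictly below \<open>x\<close>.\<close>

definition rank :: "'a set \<Rightarrow> 'a \<Rightarrow> nat" where
  "rank T x = card {y \<in> T. y \<sqsubseteq> x \<and> y \<noteq> x}"

lemma rank_less:
  assumes "finite T" "T \<subseteq> L" "x \<in> T" "y \<in> L" "x \<sqsubseteq> y" "x \<noteq> y"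
  shows "rank T x < rank T y"
proof -
  have "x \<in> L"
    using assms by blast
  then have "z \<sqsubseteq> y" "z \<noteq> y" if "z \<in> T" "z \<sqsubseteq> x" "z \<noteq> x" for z
    using that assms le_trans[of z x y] le_antisym[of x y] by blast+
  then have "{z \<in> T. z \<sqsubseteq> x \<and> z \<noteq> x} \<subset> {z \<in> T. z \<sqsubseteq> y \<and> z \<noteq> y}"
    using assms(3,5,6) by blast
  then show ?thesis
    unfolding rank_def using assms(1) by (intro psubset_card_mono) simp_all
qed

lemma rank_less_card:
  assumes "finite T" "x \<in> T"
  shows "rank T x < card T"
proof -
  have "{y \<in> T. y \<sqsubseteq> x \<and> y \<noteq> x} \<subset> T"
    using assms(2) by blast
  then show ?thesis
    unfolding rank_def using assms(1) by (intro psubset_card_mono)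
qed

lemma rank_bij:
  assumes "finite T" "T \<subseteq> L"
  shows "bij_betw (rank T) T {..<card T}"
proof -
  have "rank T x \<noteq> rank T y" if "x \<in> T" "y \<in> T" "x \<noteq> y" for x y
    using le_total[of x y] rank_less[OF assms, of x y] rank_less[OF assms, of y x] that assms(2)
    by (metis less_irrefl subsetD)
  then have inj: "inj_on (rank T) T"
    by (meson inj_onI)
  moreover have "rank T ` T = {..<card T}"
    using rank_less_card[OF assms(1)] by (intro card_subset_eq) (auto simp: card_image[OF inj])
  ultimately show ?thesis
    by (simp add: bij_betw_def)
qed

text \<open>The top element goes to the top of the possibly longer chain; all other elements go to their
  rank.\<close>

lemma embedding_in_chain_algebra:
  assumes fin: "finite L" and n: "card L \<le> n"
  obtains h where "dqd_hom h A (chain_algebra n)" "inj_on h L"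
proof -
  define h where "h x = (if x = \<top> then n - 1 else rank L x)" for x
  have less: "h x < h y" if xy: "x \<in> L" "y \<in> L" "x \<sqsubseteq> y" "x \<noteq> y" for x y
  proof -
    have "x \<noteq> \<top>"
      using xy by auto
    moreover have "rank L x < rank L y" "rank L y < card L"
      using rank_less[OF fin _ xy(1-4)] rank_less_card[OF fin xy(2)] by auto
    ultimately show ?thesis
      using n by (auto simp: h_def)
  qed
  have neq: "h x \<noteq> h y" if "x \<in> L" "y \<in> L" "x \<noteq> y" for x y
    using less[of x y] less[of y x] le_total[OF that(1,2)] that by (metis less_irrefl)
  have le: "h x \<le> h y \<longleftrightarrow> x \<sqsubseteq> y" if "x \<in> L" "y \<in> L" for x y
    using less[of x y] less[of y x] le_total[OF that] meet_idem that
    by (metis less_imp_le not_less order_refl)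
  have bound: "h x < n" if "x \<in> L" for x
    using rank_less_card[OF fin that] n by (auto simp: h_def)
  have top: "h \<top> = n - 1"
    by (simp add: h_def)
  have "{y \<in> L. y \<sqsubseteq> \<bottom> \<and> y \<noteq> \<bottom>} = {}"
    by auto
  then have "rank L \<bottom> = 0"
    unfolding rank_def by (simp only: card.empty)
  then have bot: "h \<bottom> = 0"
    using nontrivial by (simp add: h_def)
  have dual: "h (x\<^sup>d) = (if h x = n - 1 then 0 else n - 1)" if "x \<in> L" for x
    using neq[of x \<top>] that by (auto simp: dual_eq top bot)
  have "h (x \<squnion> y) = max (h x) (h y)" "h (x \<sqinter> y) = min (h x) (h y)"
    "h (x \<rightarrow> y) = (if h x \<le> h y then n - 1 else h y)" if xy: "x \<in> L" "y \<in> L" for x y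
  proof -
    have meet: "x \<sqinter> y = (if h x \<le> h y then x else y)"
      using meet_eq[OF xy] by (simp only: le[OF xy])
    show "h (x \<squnion> y) = max (h x) (h y)"
      by (simp add: join_eq[OF xy] max_def flip: le[OF xy])
    show "h (x \<sqinter> y) = min (h x) (h y)"
      by (simp add: meet min_def)
    show "h (x \<rightarrow> y) = (if h x \<le> h y then n - 1 else h y)"
      by (simp add: imp_eq[OF xy] top flip: le[OF xy])
  qed
  then have "dqd_hom h A (chain_algebra n)"
    unfolding dqd_hom_def chain_algebra_def by (simp add: bound top bot dual)
  moreover have "inj_on h L"
    using neq by (meson inj_onI)
  ultimately show thesis
    using that by blast
qed

lemma eval_big_join_neq_top:
  assumes \<rho>: "range \<rho> \<subseteq> L" and "\<And>t. t \<in> set ts \<Longrightarrow> eval A \<rho> t \<noteq> \<top>"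
  shows "eval A \<rho> (big_join ts) \<noteq> \<top>"
  using assms(2)
proof (induction ts rule: big_join.induct)
  case 1
  then show ?case
    by (simp add: nontrivial)
next
  case (2 t)
  then show ?case
    by simp
next
  case (3 t u ts)
  have "eval A \<rho> w \<in> L" for w
    by (rule eval_in_carrier[OF algebra \<rho>])
  moreover have "eval A \<rho> t \<noteq> \<top>" "eval A \<rho> (big_join (u # ts)) \<noteq> \<top>"
    using 3 by auto
  ultimately show ?case
    by (simp add: join_eq)
qed

text \<open>A chain with \<open>n\<close> elements below the top refutes the identity: assign them to the variables
  in decreasing order.\<close>

lemma card_le_if_chain_identity:
  assumes "A \<Turnstile> chain_identity n"
  shows "finite L \<and> card L \<le> n"
proof (rule ccontr)
  assume neg: "\<not> ?thesis"
  have "\<exists>T \<subseteq> L - {\<top>}. finite T \<and> card T = n"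
  proof (cases "finite L")
    case True
    then have "n \<le> card (L - {\<top>})"
      using neg by simp
    then show ?thesis
      by (meson True finite_Diff finite_subset obtain_subset_with_card_n)
  next
    case False
    then show ?thesis
      using infinite_arbitrarily_large[of "L - {\<top>}" n] by auto
  qed
  then obtain T where T: "T \<subseteq> L - {\<top>}" "finite T" "card T = n"
    by blast
  then have TL: "T \<subseteq> L"
    by blast
  have bij: "bij_betw (rank T) T {..<n}"
    using rank_bij[OF T(2) TL] T(3) by simp
  define \<rho> where "\<rho> i = (if 1 \<le> i \<and> i \<le> n then inv_into T (rank T) (n - i) else \<bottom>)" for i
  have \<rho>T: "\<rho> i \<in> T" "rank T (\<rho> i) = n - i" if "1 \<le> i" "i \<le> n" for i
  proof -
    have "n - i \<in> rank T ` T"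
      using bij that by (auto simp: bij_betw_def)
    then show "\<rho> i \<in> T" "rank T (\<rho> i) = n - i"
      using that by (simp_all add: \<rho>_def inv_into_into f_inv_into_f)
  qed
  have \<rho>L: "\<rho> i \<in> L" for i
    using \<rho>T(1)[of i] TL by (cases "1 \<le> i \<and> i \<le> n") (auto simp: \<rho>_def)
  have \<rho>_top: "\<rho> i \<noteq> \<top>" if "1 \<le> i" "i \<le> n" for i
    using \<rho>T(1)[OF that] T(1) by blast
  have decr: "\<not> \<rho> i \<sqsubseteq> \<rho> (i + 1)" if i: "1 \<le> i" "i < n" for i
  proof
    assume le: "\<rho> i \<sqsubseteq> \<rho> (i + 1)"
    have ranks: "rank T (\<rho> i) = n - i" "rank T (\<rho> (i + 1)) = n - (i + 1)"
      using \<rho>T(2)[of i] \<rho>T(2)[of "i + 1"] i by simp_all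
    then have "\<rho> i \<noteq> \<rho> (i + 1)"
      using i by (metis Suc_eq_plus1 diff_less_mono2 lessI less_irrefl)
    then have "rank T (\<rho> i) < rank T (\<rho> (i + 1))"
      using rank_less[OF T(2) TL _ \<rho>L le] \<rho>T(1)[of i] i by simp
    then show False
      unfolding ranks by simp
  qed
  have "eval A \<rho> t \<noteq> \<top>" if t: "t \<in> set (chain_terms n)" for t
  proof -
    have "(\<exists>i. t = Var i \<and> 1 \<le> i \<and> i \<le> n) \<or>
        (\<exists>i. t = (Var i \<^bold>\<rightarrow> Var (i + 1)) \<and> 1 \<le> i \<and> i < n)"
      using t unfolding set_chain_terms by blast
    then show ?thesis
    proof (elim disjE exE conjE)
      fix i assume "t = Var i" "1 \<le> i" "i \<le> n"
      then show ?thesis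
        by (simp add: \<rho>_top)
    next
      fix i assume i: "t = (Var i \<^bold>\<rightarrow> Var (i + 1))" "1 \<le> i" "i < n"
      then have "eval A \<rho> t = \<rho> (i + 1)"
        using decr[OF i(2,3)] \<rho>L by (simp add: imp_eq)
      then show ?thesis
        using \<rho>_top[of "i + 1"] i by simp
    qed
  qed
  moreover have range: "range \<rho> \<subseteq> L"
    using \<rho>L by blast
  ultimately have "eval A \<rho> (big_join (chain_terms n)) \<noteq> \<top>"
    by (intro eval_big_join_neq_top)
  moreover have "eval A \<rho> (big_join (chain_terms n)) = \<top>"
    using assms range unfolding satisfies_def chain_identity_def fst_conv snd_conv eval.simps
    by blast
  ultimately show False
    by simp
qed

end


section \<open>Simple JIDL1-algebras\<close>

text \<open>Simplicity is used in the form that the central elements \<open>x \<and> x'\<^sup>*\<close> are trivial.\<close>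

locale simple_jidl = jidl +
  assumes simple: "\<And>x. x \<in> L \<Longrightarrow> x \<sqinter> \<sim> x\<^sup>d \<in> {\<bottom>, \<top>}" and nontrivial: "\<bottom> \<noteq> \<top>"
begin

lemma le_dual:
  assumes [simp]: "x \<in> L" and "x \<noteq> \<top>"
  shows "x \<sqsubseteq> x\<^sup>d"
proof -
  have "x \<sqinter> \<sim> x\<^sup>d \<noteq> \<top>"
    using assms(2) meet_le1[of x "\<sim> x\<^sup>d"] by auto
  then have "x \<sqinter> \<sim> x\<^sup>d = \<bottom>"
    using simple[of x] by auto
  then have "x \<sqinter> (x\<^sup>d \<squnion> \<sim> x\<^sup>d) = x \<sqinter> x\<^sup>d"
    by (simp add: meet_join_distrib)
  then show ?thesis
    using dual_complemented(2)[of x] by simp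
qed

lemma dual_cases:
  assumes [simp]: "x \<in> L"
  shows "x = \<top> \<or> x\<^sup>d = \<top> \<or> x\<^sup>d = x"
proof (rule ccontr)
  assume neg: "\<not> ?thesis"
  then have "x \<sqsubseteq> x\<^sup>d" "x\<^sup>d \<sqsubseteq> x\<^sup>d\<^sup>d"
    using le_dual[of x] le_dual[of "x\<^sup>d"] by auto
  then have "x\<^sup>d = x"
    using le_trans[of "x\<^sup>d" "x\<^sup>d\<^sup>d" x] dual_dual_le[of x] le_antisym[of "x\<^sup>d" x] by simp
  then show False
    using neg by simp
qed

text \<open>Now \<open>x'' = 0\<close> for all \<open>x \<noteq> 1\<close>, so a join can be 1 only if one of the joinands is; prelinearity
  then makes any two elements comparable.\<close>

lemma dually_stone_chain_if_no_fixpoint: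
  assumes nofix: "\<And>x. x \<in> L \<Longrightarrow> x \<noteq> \<top> \<Longrightarrow> x\<^sup>d \<noteq> x"
  shows "dually_stone_chain A"
proof
  have dual: "x\<^sup>d = \<top>" if "x \<in> L" "x \<noteq> \<top>" for x
    using that nofix dual_cases by blast
  have imp: "x \<rightarrow> y = \<top> \<or> y \<rightarrow> x = \<top>" if [simp]: "x \<in> L" "y \<in> L" for x y
  proof (rule ccontr)
    assume "\<not> ?thesis"
    then have "(x \<rightarrow> y)\<^sup>d\<^sup>d = \<bottom>" "(y \<rightarrow> x)\<^sup>d\<^sup>d = \<bottom>"
      using dual dual_top by simp_all
    moreover have "((x \<rightarrow> y) \<squnion> (y \<rightarrow> x))\<^sup>d\<^sup>d = \<top>"
      by (simp add: prelinear dual_top dual_bot)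
    ultimately show False
      using nontrivial by (simp add: dual_dual_join)
  qed
  have stone: "x\<^sup>d \<sqinter> x\<^sup>d\<^sup>d = \<bottom>" if "x \<in> L" for x
    using that dual by (cases "x = \<top>") (simp_all add: dual_top)
  have heyting: "(x \<sqinter> y) \<rightarrow> y = \<top>" if [simp]: "x \<in> L" "y \<in> L" for x y
  proof (rule ccontr)
    assume neg: "\<not> ?thesis"
    then have "y \<sqsubseteq> x \<sqinter> y"
      using imp[of "x \<sqinter> y" y] imp_eq_top_imp_le[of y "x \<sqinter> y"] by simp
    then have "x \<sqinter> y = y"
      using le_antisym[of y "x \<sqinter> y"] meet_le2[of x y] by simp
    then show False
      using neg imp_self by simp
  qed
  have "is_chain A"
    unfolding is_chain_def
  proof (intro ballI)
    fix x y assume xy: "x \<in> L" "y \<in> L"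
    then show "x \<sqinter> y = x \<or> x \<sqinter> y = y"
      using imp[OF xy] imp_eq_top_imp_le[of x y] imp_eq_top_imp_le[of y x] meet_comm[OF xy] by metis
  qed
  then show "dually_stone_heyting_chain A"
    unfolding dually_stone_heyting_chain_def satisfies_def
    using in_DQD stone heyting by (simp add: range_subsetD)
qed (rule nontrivial)

text \<open>A fixed point \<open>a\<close> of the dual and its complement \<open>b\<close> are both atoms; the embedding records
  which of them lie below an element.\<close>

lemma embedding_in_D2_if_fixpoint:
  assumes a [simp]: "a \<in> L" and "a \<noteq> \<top>" and fixa: "a\<^sup>d = a"
  obtains h where "dqd_hom h A D2" "inj_on h L"
proof -
  define b where "b = \<sim> a"
  have b [simp]: "b \<in> L"
    by (simp add: b_def)
  have a_bot: "a \<noteq> \<bottom>"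
    using fixa nontrivial dual_bot by auto
  have ab: "a \<sqinter> b = \<bottom>" "a \<squnion> b = \<top>"
    using dual_complemented[of a] by (simp_all add: fixa b_def)
  then have ba: "b \<sqinter> a = \<bottom>" "b \<squnion> a = \<top>"
    by (simp_all add: meet_comm[of b a] join_comm[of b a])
  have b_top: "b \<noteq> \<top>" and b_bot: "b \<noteq> \<bottom>"
    using ab a_bot assms(2) by auto
  have "b\<^sup>d \<noteq> \<top>"
  proof
    assume "b\<^sup>d = \<top>"
    then have "(a \<squnion> b)\<^sup>d\<^sup>d = a"
      by (simp add: dual_dual_join fixa dual_top)
    then show False
      using assms(2) by (simp add: ab dual_top dual_bot)
  qed
  then have fixb: "b\<^sup>d = b"
    using dual_cases[OF b] b_top by blast
  \<comment> \<open>stated for complementary fixed points \<open>p\<close>, \<open>q\<close> so that it applies to \<open>a\<close> and \<open>b\<close> alike\<close>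
  have atom: "x \<sqinter> p = \<bottom> \<or> p \<sqsubseteq> x" if [simp]: "p \<in> L" "q \<in> L" "x \<in> L"
    and pq: "p\<^sup>d = p" "q\<^sup>d = q" "p \<sqinter> q = \<bottom>" "p \<squnion> q = \<top>" for p q x
  proof (cases "p \<sqsubseteq> x")
    case False
    \<comment> \<open>If \<open>y = x \<and> p\<close> is strictly below \<open>p\<close>, then \<open>y' = 1\<close>, so \<open>y \<or> q\<close> has the same double dual
      as \<open>q\<close> and hence dual \<open>q\<close>; as \<open>y \<or> q \<noteq> 1\<close>, it lies below its dual \<open>q\<close>.\<close>
    let ?y = "x \<sqinter> p" and ?z = "(x \<sqinter> p) \<squnion> q"
    have "?y \<noteq> \<top>"
      using False meet_le2[of x p] meet_le1[of x p] by auto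
    have "?y \<noteq> p"
      using False meet_comm[of x p] by auto
    have dz: "?z \<noteq> \<top>"
    proof
      assume "?z = \<top>"
      then have "p \<sqinter> ?z = p"
        by simp
      then have "p \<sqinter> (x \<sqinter> p) = p"
        by (simp add: meet_join_distrib pq(3))
      then show False
        using \<open>?y \<noteq> p\<close> meet_le2[of x p] meet_comm[of p "x \<sqinter> p"] by simp
    qed
    have "?y\<^sup>d = \<top>"
    proof (rule ccontr)
      assume "?y\<^sup>d \<noteq> \<top>"
      then have "?y\<^sup>d = ?y"
        using dual_cases[of ?y] \<open>?y \<noteq> \<top>\<close> by auto
      then have "p \<sqsubseteq> ?y"
        using dual_antimono[of ?y p] meet_le2[of x p] pq(1) by simp
      then show False
        using \<open>?y \<noteq> p\<close> meet_le2[of x p] le_antisym[of ?y p] by simp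
    qed
    then have "?z\<^sup>d\<^sup>d = q"
      by (simp add: dual_dual_join pq(2) dual_top)
    then have "?z\<^sup>d = q"
      using dual_dual_dual[of ?z] pq(2) by simp
    then have "?z \<sqsubseteq> q"
      using le_dual[OF _ dz] by simp
    then have "?y \<sqsubseteq> q"
      using le_trans[of ?y ?z q] join_ge1[of ?y q] by simp
    then have "?y = x \<sqinter> (p \<sqinter> q)"
      by (simp add: meet_assoc)
    then show ?thesis
      by (simp add: pq(3))
  qed simp
  have atom_a: "x \<sqinter> a = \<bottom> \<or> a \<sqsubseteq> x" if "x \<in> L" for x
    using atom[OF a b that fixa fixb ab] .
  have atom_b: "x \<sqinter> b = \<bottom> \<or> b \<sqsubseteq> x" if "x \<in> L" for x
    using atom[OF b a that fixb fixa ba] .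
  have bot_imp_top: "\<bottom> \<rightarrow> \<top> = \<top>"
    using prelinear[of \<bottom> \<top>] by (simp add: top_imp)
  have below_join: "p \<sqsubseteq> x \<squnion> y \<longleftrightarrow> p \<sqsubseteq> x \<or> p \<sqsubseteq> y"
    and below_imp: "p \<sqsubseteq> (x \<rightarrow> y) \<longleftrightarrow> (p \<sqsubseteq> x \<longrightarrow> p \<sqsubseteq> y)"
    if p: "p = a \<or> p = b" and [simp]: "x \<in> L" "y \<in> L" for p x y
  proof -
    have [simp]: "p \<in> L" and p_bot: "p \<noteq> \<bottom>"
      using p a_bot b_bot by auto
    have val: "p \<sqinter> z = (if p \<sqsubseteq> z then p else \<bottom>)" if [simp]: "z \<in> L" for z
      using p atom_a[of z] atom_b[of z] meet_comm[of p z] by auto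
    have "p \<sqinter> (x \<squnion> y) = (p \<sqinter> x) \<squnion> (p \<sqinter> y)"
      by (simp add: meet_join_distrib)
    then show "p \<sqsubseteq> x \<squnion> y \<longleftrightarrow> p \<sqsubseteq> x \<or> p \<sqsubseteq> y"
      using val[of x] val[of y] p_bot join_ge1[of p p] le_iff_join[of p p] meet_idem[of p]
      by (auto split: if_splits)
    have rel: "p \<sqinter> (x \<rightarrow> y) = p \<sqinter> ((p \<sqinter> x) \<rightarrow> (p \<sqinter> y))"
      by (rule meet_imp_relativize) simp_all
    have "p \<sqinter> (\<bottom> \<rightarrow> p) = p \<sqinter> (\<bottom> \<rightarrow> \<top>)"
      using meet_imp_relativize[of p \<bottom> \<top>] by simp
    then have bot_p: "p \<sqinter> (\<bottom> \<rightarrow> p) = p"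
      by (simp add: bot_imp_top)
    show "p \<sqsubseteq> (x \<rightarrow> y) \<longleftrightarrow> (p \<sqsubseteq> x \<longrightarrow> p \<sqsubseteq> y)"
      unfolding rel using val[of x] val[of y] p_bot bot_p meet_imp[of p \<bottom>] imp_self[of p] imp_self[of \<bottom>]
      by (cases "p \<sqsubseteq> x"; cases "p \<sqsubseteq> y") simp_all
  qed
  have below_meet: "p \<sqsubseteq> x \<sqinter> y \<longleftrightarrow> p \<sqsubseteq> x \<and> p \<sqsubseteq> y"
    if [simp]: "p \<in> L" "x \<in> L" "y \<in> L" for p x y
    using meet_greatest[of p x y] le_trans[of p "x \<sqinter> y" x] le_trans[of p "x \<sqinter> y" y]
      meet_le1[of x y] meet_le2[of x y] by auto
  define h where "h x = (a \<sqsubseteq> x, b \<sqsubseteq> x)" for x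
  have decompose: "x = (x \<sqinter> a) \<squnion> (x \<sqinter> b)" if [simp]: "x \<in> L" for x
    by (simp add: ab flip: meet_join_distrib)
  have part: "x \<sqinter> a = (if a \<sqsubseteq> x then a else \<bottom>)" "x \<sqinter> b = (if b \<sqsubseteq> x then b else \<bottom>)"
    if [simp]: "x \<in> L" for x
    using atom_a[of x] atom_b[of x] meet_comm[of x a] meet_comm[of x b] by auto
  have inj: "inj_on h L"
  proof (rule inj_onI)
    fix x y assume xy: "x \<in> L" "y \<in> L" "h x = h y"
    then have "x \<sqinter> a = y \<sqinter> a" "x \<sqinter> b = y \<sqinter> b"
      unfolding part[OF xy(1)] part[OF xy(2)] h_def by auto
    then show "x = y"
      using decompose[OF xy(1)] decompose[OF xy(2)] by metis
  qed
  have h_vals: "h \<bottom> = (False, False)" "h \<top> = (True, True)" "h a = (True, False)"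
    "h b = (False, True)"
    using a_bot b_bot ab ba by (auto simp: h_def meet_idem)
  have elems: "x \<in> {\<bottom>, \<top>, a, b}" if x: "x \<in> L" for x
  proof -
    have "h x = h \<bottom> \<or> h x = h \<top> \<or> h x = h a \<or> h x = h b"
      unfolding h_vals by (cases "h x") auto
    then show ?thesis
      using inj_onD[OF inj] x by auto
  qed
  have dual: "h (x\<^sup>d) = dual D2 (h x)" if "x \<in> L" for x
    using elems[OF that] by (auto simp: fixa fixb dual_top dual_bot h_vals D2_def)
  have "h (x \<squnion> y) = join D2 (h x) (h y)" "h (x \<sqinter> y) = meet D2 (h x) (h y)"
    "h (x \<rightarrow> y) = imp D2 (h x) (h y)" if "x \<in> L" "y \<in> L" for x y
    using that by (simp_all add: h_def D2_def below_join below_imp below_meet)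
  then have "dqd_hom h A D2"
    unfolding dqd_hom_def using dual h_vals by (simp add: D2_def)
  then show thesis
    using that inj by blast
qed

end

lemma (in jidl) separating_hom:
  assumes id: "A \<Turnstile> chain_identity n" and ab: "a \<in> L" "b \<in> L" "a \<noteq> b"
  shows "(\<exists>h. dqd_hom h A (chain_algebra n) \<and> h a \<noteq> h b) \<or> (\<exists>h. dqd_hom h A D2 \<and> h a \<noteq> h b)"
proof -
  obtain r and Q :: "'a dqd_struct" where r: "dqd_hom r A Q" "r ` L = carrier Q" "r a \<noteq> r b"
    and Q: "\<And>x. x \<in> carrier Q \<Longrightarrow> meet Q x (imp Q (dual Q x) (zero Q)) \<in> {zero Q, one Q}"
    using simple_quotient[OF ab] by blast
  have rab: "r a \<in> carrier Q" "r b \<in> carrier Q"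
    using r(2) ab by blast+
  have QJ: "Q \<in> JIDL1"
    using in_JIDL1 is_algebra_image[OF algebra r(1,2)] satisfies_image[OF algebra r(1,2)]
    unfolding JIDL1_def models_def by blast
  interpret Q: dqd Q
    by (rule dqd.intro[OF JIDL1_imp_DQD[OF QJ]])
  have nontrivial: "zero Q \<noteq> one Q"
  proof
    assume eq: "zero Q = one Q"
    then have "x = zero Q" if "x \<in> carrier Q" for x
      using Q.bounds(3,5)[OF that] by simp
    then show False
      using rab r(3) by metis
  qed
  interpret Q: simple_jidl Q
    by unfold_locales (use QJ Q nontrivial in auto)
  have comp: "dqd_hom (h \<circ> r) A B \<and> (h \<circ> r) a \<noteq> (h \<circ> r) b"
    if "dqd_hom h Q B" "inj_on h (carrier Q)" for h and B :: "'x dqd_struct"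
    using that r rab inj_onD[OF that(2), of "r a" "r b"] by (auto simp: dqd_hom_def)
  show ?thesis
  proof (cases "\<exists>x\<in>carrier Q. x \<noteq> one Q \<and> dual Q x = x")
    case True
    then obtain h where "dqd_hom h Q D2" "inj_on h (carrier Q)"
      using Q.embedding_in_D2_if_fixpoint by metis
    from comp[OF this] show ?thesis
      by blast
  next
    case False
    then interpret C: dually_stone_chain Q
      by (intro Q.dually_stone_chain_if_no_fixpoint) blast
    have "finite (carrier Q) \<and> card (carrier Q) \<le> n"
      by (rule C.card_le_if_chain_identity[OF satisfies_image[OF algebra r(1,2) id]])
    then obtain h where "dqd_hom h Q (chain_algebra n)" "inj_on h (carrier Q)"
      using C.embedding_in_chain_algebra by metis
    from comp[OF this] show ?thesis
      by blast
  qed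
qed

text \<open>A chain with exactly \<open>n\<close> elements is embedded onto the standard one.\<close>

lemma satisfies_iff_chain_algebra:
  assumes "n \<ge> 2" "dually_stone_heyting_chain C" "card (carrier C) = n"
  shows "C \<Turnstile> e \<longleftrightarrow> chain_algebra n \<Turnstile> e"
proof -
  interpret dqd C
    using assms(2) by (intro dqd.intro) (simp add: dually_stone_heyting_chain_def)
  have fin: "finite L"
    using assms by (intro card_ge_0_finite) simp
  interpret dually_stone_chain C
  proof
    show "zero C \<noteq> one C"
    proof
      assume eq: "zero C = one C"
      then have "x = zero C" if "x \<in> L" for x
        using bounds(3,5)[OF that] by simp
      then have "L \<subseteq> {zero C}"
        by blast
      then have "card L \<le> card {zero C}"
        by (intro card_mono) simp
      then show False
        using assms by simp
    qed
  qed (rule assms(2))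
  obtain h where h: "dqd_hom h C (chain_algebra n)" "inj_on h L"
    using embedding_in_chain_algebra[OF fin] assms(3) by blast
  have "h ` L \<subseteq> carrier (chain_algebra n)"
    using h(1) by (auto simp: dqd_hom_def)
  moreover have "card (h ` L) = card (carrier (chain_algebra n))"
    using card_image[OF h(2)] assms(3) by (simp add: chain_algebra_def)
  ultimately have "h ` L = carrier (chain_algebra n)"
    by (intro card_subset_eq) (simp_all add: chain_algebra_def)
  then show ?thesis
    using satisfies_image[OF algebra h(1)] satisfies_if_embeds[OF algebra h] by blast
qed

theorem corollary7p4:
  fixes n :: nat and C :: "'c dqd_struct"
  assumes "n \<ge> 2"
    and "dually_stone_heyting_chain C" and "card (carrier C) = n"
  shows "variety_of {C} \<squnion>\<^sub>V variety_of {D2} =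
    {A :: 'a::infinite dqd_struct. A \<in> JIDL1 \<and> A \<Turnstile> chain_identity n}"
proof -
  have "is_algebra C" "is_algebra D2"
    using assms(2) D2_in_DQD by (simp_all add: dually_stone_heyting_chain_def DQD_def models_def)
  moreover have "finite (carrier C)" "finite (carrier D2)"
    using assms(1,3) by (auto intro: card_ge_0_finite simp: D2_def)
  ultimately have "(variety_of {C} \<squnion>\<^sub>V variety_of {D2} :: 'a dqd_struct set) =
      models {e. C \<Turnstile> e \<and> D2 \<Turnstile> e}"
    by (intro variety_join_eq)
  also have "\<dots> = models {e. chain_algebra n \<Turnstile> e \<and> D2 \<Turnstile> e}"
    using satisfies_iff_chain_algebra[OF assms] by simp
  also have "\<dots> = {A. A \<in> JIDL1 \<and> A \<Turnstile> chain_identity n}"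
  proof (intro equalityI subsetI)
    fix A :: "'a dqd_struct"
    assume A: "A \<in> models {e. chain_algebra n \<Turnstile> e \<and> D2 \<Turnstile> e}"
    have "A \<in> JIDL1"
      using A chain_algebra_JIDL1[OF assms(1)] D2_JIDL1 unfolding JIDL1_def models_def by blast
    moreover have "A \<Turnstile> chain_identity n"
      using A chain_algebra_chain_identity[OF assms(1)] D2_chain_identity[OF assms(1)]
      unfolding models_def by blast
    ultimately show "A \<in> {A. A \<in> JIDL1 \<and> A \<Turnstile> chain_identity n}"
      by blast
  next
    fix A :: "'a dqd_struct"
    assume A: "A \<in> {A. A \<in> JIDL1 \<and> A \<Turnstile> chain_identity n}"
    then interpret jidl A
      by unfold_locales (auto intro: JIDL1_imp_DQD)
    have "A \<Turnstile> chain_identity n"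
      using A by blast
    note sep = separating_hom[OF this]
    have "A \<Turnstile> e" if e: "chain_algebra n \<Turnstile> e" "D2 \<Turnstile> e" for e
    proof (rule satisfies_if_separated[OF algebra])
      fix x y assume "x \<in> L" "y \<in> L" "x \<noteq> y"
      from sep[OF this] e
      show "(\<exists>h. dqd_hom h A (chain_algebra n) \<and> chain_algebra n \<Turnstile> e \<and> h x \<noteq> h y) \<or>
          (\<exists>h. dqd_hom h A D2 \<and> D2 \<Turnstile> e \<and> h x \<noteq> h y)"
        by blast
    qed
    then show "A \<in> models {e. chain_algebra n \<Turnstile> e \<and> D2 \<Turnstile> e}"
      using algebra unfolding models_def by blast
  qed
  finally show ?thesis .
qed

end
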